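(* Fix $j>0$. There exist constants $c<\infty$ and $b>0$, independent of $N$, such that for every integer $N\ge 2$, every probability measure $\mu_N$ on $\{0,1\}^{[-N,N]}$ and every $t>0$, $$\|\mu_N S_t-\mu^{\rm st}_N\|\le c\,N\,e^{-bN^{-2}t}.$$
   Context: For a positive integer $N$, consider the continuous-time Markov process on $\{0,1\}^{[-N,N]}$ with generator $L=L_0+L_{b,+}+L_{b,-}$, where for $f:\{0,1\}^{[-N,N]}\to\mathbb R$, $$L_0 f(\eta)=\frac12\sum_{x=-N}^{N-1}[f(\eta^{(x,x+1)})-f(\eta)],$$ $\eta^{(x,x+1)}$ being $\eta$ with the values at $x$ and $x+1$ exchanged, and $$L_{b,\pm}f(\eta)=\frac{j}{2N}\sum_{x\in I_\pm}D_\pm\eta(x)\,[f(\eta^{(x)})-f(\eta)],$$ with $I_+=\{N-1,N\}$, $I_-=\{-N,-N+1\}$, $\eta^{(x)}$ the configuration $\eta$ with the value at $x$ flipped ($\eta(x)\mapsto 1-\eta(x)$), and $$D_+\eta(x)=(1-\eta(x))\,\eta(x+1)\cdots\eta(N),\qquad D_-\eta(x)=\eta(x)\,(1-\eta(x-1))\cdots(1-\eta(-N))$$ (empty products equal $1$). Thus at rate $j/(2N)$ a particle is added at the last empty site of $I_+$ (if any) and at rate $j/(2N)$ the first particle in $I_-$ (if any) is removed. This process has a unique stationary probability measure $\mu^{\rm st}_N$. For a probability measure $\mu_N$, $\mu_NS_t$ denotes the law at time $t$ of the process started with law $\mu_N$. For a signed measure $\lambda$ on $\{0,1\}^{[-N,N]}$,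 $\|\lambda\|=\sum_\eta|\lambda(\eta)|$. *)

theory Defs
  imports Complex_Main
begin

text \<open>A configuration eta in {0,1}^[-N,N] is represented by the set of occupied
  sites, a subset of {-N..N}; eta(x) = 1 iff x is in the set.\<close>

definition states :: "nat \<Rightarrow> int set set" where
  "states N = Pow {- int N .. int N}"

definition occ :: "int set \<Rightarrow> int \<Rightarrow> real" where
  "occ \<eta> x = (if x \<in> \<eta> then 1 else 0)"

definition swap :: "int set \<Rightarrow> int \<Rightarrow> int set" where
  "swap \<eta> x = {y. (y \<noteq> x \<and> y \<noteq> x + 1 \<and> y \<in> \<eta>) \<or> (y = x \<and> x + 1 \<in> \<eta>) \<or> (y = x + 1 \<and> x \<in> \<eta>)}"

definition flip :: "int set \<Rightarrow> int \<Rightarrow> int set" where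
  "flip \<eta> x = (if x \<in> \<eta> then \<eta> - {x} else insert x \<eta>)"

definition D_plus :: "nat \<Rightarrow> int set \<Rightarrow> int \<Rightarrow> real" where
  "D_plus N \<eta> x = (1 - occ \<eta> x) * (\<Prod>y\<in>{x + 1 .. int N}. occ \<eta> y)"

definition D_minus :: "nat \<Rightarrow> int set \<Rightarrow> int \<Rightarrow> real" where
  "D_minus N \<eta> x = occ \<eta> x * (\<Prod>y\<in>{- int N .. x - 1}. (1 - occ \<eta> y))"

definition I_plus :: "nat \<Rightarrow> int set" where
  "I_plus N = {int N - 1, int N}"

definition I_minus :: "nat \<Rightarrow> int set" where
  "I_minus N = {- int N, - int N + 1}"

definition L0 :: "nat \<Rightarrow> (int set \<Rightarrow> real) \<Rightarrow> int set \<Rightarrow> real" where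
  "L0 N f \<eta> = 1/2 * (\<Sum>x\<in>{- int N .. int N - 1}. f (swap \<eta> x) - f \<eta>)"

definition Lb_plus :: "nat \<Rightarrow> real \<Rightarrow> (int set \<Rightarrow> real) \<Rightarrow> int set \<Rightarrow> real" where
  "Lb_plus N j f \<eta> = j / (2 * real N) * (\<Sum>x\<in>I_plus N. D_plus N \<eta> x * (f (flip \<eta> x) - f \<eta>))"

definition Lb_minus :: "nat \<Rightarrow> real \<Rightarrow> (int set \<Rightarrow> real) \<Rightarrow> int set \<Rightarrow> real" where
  "Lb_minus N j f \<eta> = j / (2 * real N) * (\<Sum>x\<in>I_minus N. D_minus N \<eta> x * (f (flip \<eta> x) - f \<eta>))"

definition gen :: "nat \<Rightarrow> real \<Rightarrow> (int set \<Rightarrow> real) \<Rightarrow> int set \<Rightarrow> real" where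
  "gen N j f \<eta> = L0 N f \<eta> + Lb_plus N j f \<eta> + Lb_minus N j f \<eta>"

text \<open>Transition-rate matrix Q(eta,zeta) = (L 1_zeta)(eta), and its action on
  (signed) measures from the right: (lambda Q)(zeta) = sum_eta lambda(eta) Q(eta,zeta).\<close>
definition fwd :: "nat \<Rightarrow> real \<Rightarrow> (int set \<Rightarrow> real) \<Rightarrow> int set \<Rightarrow> real" where
  "fwd N j m \<zeta> = (\<Sum>\<eta>\<in>states N. m \<eta> * gen N j (%\<xi>. if \<xi> = \<zeta> then 1 else 0) \<eta>)"

definition law :: "nat \<Rightarrow> real \<Rightarrow> (int set \<Rightarrow> real) \<Rightarrow> real \<Rightarrow> int set \<Rightarrow> real" where
  "law N j \<mu> t \<zeta> = (\<Sum>n. t ^ n / fact n * ((fwd N j ^^ n) \<mu>) \<zeta>)"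

definition is_prob :: "nat \<Rightarrow> (int set \<Rightarrow> real) \<Rightarrow> bool" where
  "is_prob N \<mu> \<longleftrightarrow> (\<forall>\<eta>. \<eta> \<notin> states N \<longrightarrow> \<mu> \<eta> = 0) \<and> (\<forall>\<eta>\<in>states N. \<mu> \<eta> \<ge> 0)
      \<and> (\<Sum>\<eta>\<in>states N. \<mu> \<eta>) = 1"

definition mu_st :: "nat \<Rightarrow> real \<Rightarrow> int set \<Rightarrow> real" where
  "mu_st N j = (THE \<mu>. is_prob N \<mu> \<and> (\<forall>t\<ge>0. \<forall>\<zeta>\<in>states N. law N j \<mu> t \<zeta> = \<mu> \<zeta>))"

definition tv_norm :: "nat \<Rightarrow> (int set \<Rightarrow> real) \<Rightarrow> real" where
  "tv_norm N m = (\<Sum>\<eta>\<in>states N. \<bar>m \<eta>\<bar>)"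

end

theory Submission
  imports Defs "HOL-Combinatorics.Transposition"
begin

text \<open>
  Exchanges, injections and removals are order-preserving random maps, so two configurations that
  differ at one site \<open>z\<close> stay coupled with at most one discrepancy (second class particle), which
  performs a random walk and dies when a boundary event hits the two sites of \<open>I\<^sub>+\<close> while the other
  site is occupied, or those of \<open>I\<^sub>-\<close> while the other site is empty. It suffices to find a function
  \<open>V \<eta> z \<in> [1/2, 1]\<close> that decreases in mean at rate of order \<open>N\<^sup>-\<^sup>2\<close> (with value 0 after death):
  then the space of functions \<open>f\<close> with \<open>\<bar>f (\<eta> \<union> {z}) - f \<eta>\<bar> \<le> c V \<eta> z\<close> is contracted by the semigroup,
  and the oscillation of such an \<open>f\<close> is at most \<open>c (2N + 1)\<close>.

  Take \<open>V = 1 - \<epsilon> K\<close>, where \<open>K\<close> sums over all \<open>y \<noteq> z\<close> the Green function, up to time of order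
  \<open>N\<^sup>2\<close>, of the exclusion pair \<open>(y, z)\<close> started from the right corner \<open>(N - 1, N)\<close> if \<open>y\<close> is
  occupied, and from the left corner if \<open>y\<close> is empty. Each of the \<open>2N\<close> sites \<open>y\<close> contributes, whether
  occupied or not, so the exchange part increases \<open>K\<close> by \<open>2N\<close> times the smallest value, of order
  \<open>N\<^sup>-\<^sup>2\<close>, of the final transition probability, except in the states where a death is possible; there
  the death pays for it. The boundary events do not decrease \<open>K\<close> on balance, since near
  the ends the Green function favours particles on the right and holes on the left.
\<close>

section \<open>The reflecting walk on a square\<close>

definition clamp :: "nat \<Rightarrow> int \<Rightarrow> int" where
  "clamp N a = max (- int N) (min (int N - 1) a)"

definition box :: "nat \<Rightarrow> int set" where
  "box N = {- int N .. int N - 1}"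

text \<open>Inside the box this is the probability that a walk from \<open>(a, b)\<close>, which
  moves one random coordinate at a time and is held at the border, sits at the corner
  \<open>(N - 1, N - 1)\<close> after \<open>l\<close> steps. The inequalities in the initial value
  keep it monotone outside the box too.\<close>

fun walk :: "nat \<Rightarrow> nat \<Rightarrow> int \<Rightarrow> int \<Rightarrow> real" where
  "walk N 0 a b = (if int N - 1 \<le> a \<and> int N - 1 \<le> b then 1 else 0)"
| "walk N (Suc l) a b =
    (walk N l (clamp N (a - 1)) b + walk N l (clamp N (a + 1)) b
     + walk N l a (clamp N (b - 1)) + walk N l a (clamp N (b + 1))) / 4"

lemma clamp_mono: "a \<le> b \<Longrightarrow> clamp N a \<le> clamp N b"
  by (auto simp: clamp_def)

lemma clamp_ge: "- int N \<le> clamp N a"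
  by (auto simp: clamp_def)

lemma finite_box [simp]: "finite (box N)"
  by (simp add: box_def)

lemma walk_nonneg: "0 \<le> walk N l a b"
  by (induction l arbitrary: a b) auto

lemma walk_sym: "walk N l a b = walk N l b a"
proof (induction l arbitrary: a b)
  case (Suc l)
  show ?case
    unfolding walk.simps Suc[of a] Suc[of "clamp N (a - 1)"] Suc[of "clamp N (a + 1)"] by simp
qed auto

lemma walk_mono: "a \<le> a' \<Longrightarrow> b \<le> b' \<Longrightarrow> walk N l a b \<le> walk N l a' b'"
proof (induction l arbitrary: a b a' b')
  case (Suc l)
  show ?case unfolding walk.simps
    by (intro divide_right_mono add_mono Suc.IH clamp_mono) (use Suc.prems in auto)
qed auto

lemma sum_box_shift:
  fixes f g :: "int \<Rightarrow> real"
  assumes "N \<ge> 1"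
  shows "(\<Sum>a\<in>box N. f (clamp N (a + 1)) * g a)
     = (\<Sum>a\<in>{- int N .. int N - 2}. f (a + 1) * g a) + f (int N - 1) * g (int N - 1)"
proof -
  have *: "box N = insert (int N - 1) {- int N .. int N - 2}"
    using assms by (auto simp: box_def)
  have "(\<Sum>a\<in>{- int N .. int N - 2}. f (clamp N (a + 1)) * g a)
      = (\<Sum>a\<in>{- int N .. int N - 2}. f (a + 1) * g a)"
    by (intro sum.cong) (auto simp: clamp_def)
  then show ?thesis using assms unfolding * by (simp add: clamp_def)
qed

lemma sum_box_shift':
  fixes f g :: "int \<Rightarrow> real"
  assumes "N \<ge> 1"
  shows "(\<Sum>a\<in>box N. f (clamp N (a - 1)) * g a)
     = (\<Sum>a\<in>{- int N .. int N - 2}. f a * g (a + 1)) + f (- int N) * g (- int N)"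
proof -
  have *: "box N = insert (- int N) {- int N + 1.. int N - 1}"
    using assms by (auto simp: box_def)
  have "(\<Sum>a\<in>{- int N + 1 .. int N - 1}. f (clamp N (a - 1)) * g a)
      = (\<Sum>a\<in>{- int N .. int N - 2}. f a * g (a + 1))"
    by (rule sum.reindex_bij_witness[of _ "\<lambda>a. a + 1" "\<lambda>a. a - 1"]) (auto simp: clamp_def)
  then show ?thesis using assms unfolding * by (simp add: clamp_def)
qed

text \<open>The two shifts are adjoint to each other up to end terms, and holding at the ends makes
  these symmetric in \<open>f\<close> and \<open>g\<close>.\<close>

lemma clamp_selfadjoint:
  fixes f g :: "int \<Rightarrow> real"
  assumes "N \<ge> 1"
  shows "(\<Sum>a\<in>box N. (f (clamp N (a - 1)) + f (clamp N (a + 1))) * g a)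
       = (\<Sum>a\<in>box N. f a * (g (clamp N (a - 1)) + g (clamp N (a + 1))))"
proof -
  have "(\<Sum>a\<in>box N. (f (clamp N (a - 1)) + f (clamp N (a + 1))) * g a)
     = (\<Sum>a\<in>box N. f (clamp N (a - 1)) * g a) + (\<Sum>a\<in>box N. f (clamp N (a + 1)) * g a)"
    by (simp add: sum.distrib distrib_right)
  also have "\<dots> = (\<Sum>a\<in>box N. g (clamp N (a - 1)) * f a) + (\<Sum>a\<in>box N. g (clamp N (a + 1)) * f a)"
    unfolding sum_box_shift[OF assms] sum_box_shift'[OF assms] by (simp add: mult.commute)
  also have "\<dots> = (\<Sum>a\<in>box N. f a * (g (clamp N (a - 1)) + g (clamp N (a + 1))))"
    by (simp add: sum.distrib distrib_left mult.commute[of "f _"])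
  finally show ?thesis .
qed

section \<open>The projection of the walk to one coordinate\<close>

text \<open>With probability 1/2 it is the other coordinate that moves, hence the pause.\<close>

definition lazy :: "nat \<Rightarrow> (int \<Rightarrow> real) \<Rightarrow> int \<Rightarrow> real" where
  "lazy N s b = s b / 2 + (s (clamp N (b - 1)) + s (clamp N (b + 1))) / 4"

lemma sum_lazy_mult:
  assumes "N \<ge> 1"
  shows "(\<Sum>b\<in>box N. lazy N s b * f b) = (\<Sum>b\<in>box N. s b * lazy N f b)"
proof -
  have "(\<Sum>b\<in>box N. lazy N s b * f b) = (\<Sum>b\<in>box N. s b * f b) / 2
      + (\<Sum>a\<in>box N. (s (clamp N (a - 1)) + s (clamp N (a + 1))) * f a) / 4"
    by (simp add: lazy_def sum.distrib sum_divide_distrib[symmetric] distrib_right add_divide_distrib)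
  also have "\<dots> = (\<Sum>b\<in>box N. s b * lazy N f b)"
    unfolding clamp_selfadjoint[OF assms]
    by (simp add: lazy_def sum.distrib sum_divide_distrib[symmetric] distrib_left add_divide_distrib)
  finally show ?thesis .
qed

lemma sum_lazy:
  assumes "N \<ge> 1"
  shows "(\<Sum>b\<in>box N. lazy N s b) = (\<Sum>b\<in>box N. s b)"
  using sum_lazy_mult[OF assms, of s "\<lambda>_. 1"] by (simp add: lazy_def)

lemma lazy_interior:
  "- int N < b \<Longrightarrow> b < int N - 1 \<Longrightarrow> lazy N f b = f b / 2 + (f (b - 1) + f (b + 1)) / 4"
  by (simp add: lazy_def clamp_def)

lemma lazy_left_end:
  "N \<ge> 1 \<Longrightarrow> lazy N f (- int N) = f (- int N) / 2 + (f (- int N) + f (- int N + 1)) / 4"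
  by (simp add: lazy_def clamp_def)

lemma lazy_right_end:
  "N \<ge> 1 \<Longrightarrow> lazy N f (int N - 1) = f (int N - 1) / 2 + (f (int N - 2) + f (int N - 1)) / 4"
  by (simp add: lazy_def clamp_def)

text \<open>The quadratic vanishes both at \<open>N - 1\<close> and at \<open>N\<close>, so holding
  at the right end changes nothing. At the left end the clamp suppresses a jump of size
  \<open>4 * N\<close>, a quarter of which is the correction.\<close>

lemma lazy_quadratic_left:
  assumes "N \<ge> 1" "b \<in> box N"
  shows "lazy N (\<lambda>b. real_of_int ((int N - 1 - b) * (int N - b))) b
     = real_of_int ((int N - 1 - b) * (int N - b)) + 1/2 - (if b = - int N then real N else 0)"
proof -
  consider "b = - int N" | "- int N < b" "b = int N - 1" | "- int N < b" "b < int N - 1"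
    using assms by (force simp: box_def)
  then show ?thesis
  proof cases
    case 1
    show ?thesis unfolding 1 lazy_left_end[OF assms(1)] by (simp add: algebra_simps) (simp add: field_simps)
  next
    case 2
    show ?thesis unfolding 2 lazy_right_end[OF assms(1)] using assms(1) by (simp add: algebra_simps)
  next
    case 3
    then show ?thesis unfolding lazy_interior[OF 3] by (simp add: algebra_simps) (simp add: field_simps)
  qed
qed

lemma lazy_quadratic_right:
  assumes "N \<ge> 1" "b \<in> box N"
  shows "lazy N (\<lambda>b. real_of_int ((b + int N) * (b + int N + 1))) b
     = real_of_int ((b + int N) * (b + int N + 1)) + 1/2 - (if b = int N - 1 then real N else 0)"
proof -
  consider "b = - int N" | "- int N < b" "b = int N - 1" | "- int N < b" "b < int N - 1"
    using assms by (force simp: box_def)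
  then show ?thesis
  proof cases
    case 1
    show ?thesis unfolding 1 lazy_left_end[OF assms(1)] using assms(1) by (simp add: algebra_simps)
  next
    case 2
    show ?thesis unfolding 2 lazy_right_end[OF assms(1)] by (simp add: algebra_simps) (simp add: field_simps)
  next
    case 3
    then show ?thesis unfolding lazy_interior[OF 3] by (simp add: algebra_simps) (simp add: field_simps)
  qed
qed

lemma lazy_mono: "mono s \<Longrightarrow> mono (lazy N s)"
  unfolding lazy_def
  by (intro monoI add_mono divide_right_mono) (auto intro!: clamp_mono elim: monoD)

lemma lazy_le: "(\<And>b. s b \<le> s' b) \<Longrightarrow> lazy N s b \<le> lazy N s' b"
  unfolding lazy_def by (intro add_mono divide_right_mono) auto

text \<open>The value at the left end is nondecreasing in time, so its time average, which the
  quadratic test function computes, bounds the final value from below.\<close>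
lemma lazy_left_end_ge:
  assumes N: "N \<ge> 1" and mono: "mono s" and nonneg: "\<And>b. 0 \<le> s b"
  shows "(\<Sum>b\<in>box N. s b) / (4 * real N) \<le> (lazy N ^^ (16 * N\<^sup>2)) s (- int N)"
proof -
  define u where "u l = (lazy N ^^ l) s" for l
  define \<mu> where "\<mu> = (\<Sum>b\<in>box N. s b)"
  define f where "f b = real_of_int ((int N - 1 - b) * (int N - b))" for b
  define F where "F l = (\<Sum>b\<in>box N. u l b * f b)" for l
  have u_Suc: "u (Suc l) = lazy N (u l)" for l by (simp add: u_def)
  have u_mono: "mono (u l)" for l
    by (induction l) (use mono in \<open>auto simp: u_def intro: lazy_mono\<close>)
  have u_nonneg: "0 \<le> u l b" for l b
    by (induction l arbitrary: b) (use nonneg in \<open>auto simp: u_def lazy_def\<close>)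
  have u_sum: "(\<Sum>b\<in>box N. u l b) = \<mu>" for l
    by (induction l) (auto simp: u_Suc sum_lazy[OF N], simp add: u_def \<mu>_def)
  have e: "- int N \<in> box N" using N by (auto simp: box_def)
  \<comment> \<open>The left end carries the minimum of a monotone function, so averaging can only
    raise it.\<close>
  have left_inc: "u l (- int N) \<le> u (Suc l) (- int N)" for l
  proof -
    have "u l (- int N) \<le> u l (clamp N b)" for b
      using u_mono[of l] clamp_ge by (auto simp: mono_def)
    moreover have "x \<le> x / 2 + (y + z) / 4" if "x \<le> y" "x \<le> z" for x y z :: real
      using that by (simp add: field_simps)
    ultimately show ?thesis unfolding u_Suc lazy_def by blast
  qed
  have F_Suc: "F (Suc l) = F l + \<mu> / 2 - real N * u l (- int N)" for l
  proof -
    have "F (Suc l) = (\<Sum>b\<in>box N. u l b * lazy N f b)"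
      by (simp add: F_def u_Suc sum_lazy_mult[OF N])
    also have "\<dots> = (\<Sum>b\<in>box N. u l b * f b + u l b / 2
        - (if b = - int N then real N * u l b else 0))"
      unfolding f_def by (intro sum.cong refl, subst lazy_quadratic_left[OF N]) (auto simp: algebra_simps)
    also have "\<dots> = F l + \<mu> / 2 - real N * u l (- int N)"
      using e by (simp add: sum.distrib sum_subtractf F_def u_sum sum_divide_distrib[symmetric])
    finally show ?thesis .
  qed
  have sum_F: "F l = F 0 + real l * \<mu> / 2 - real N * (\<Sum>i<l. u i (- int N))" for l
    by (induction l) (auto simp: F_Suc algebra_simps add_divide_distrib)
  have f_nonneg: "0 \<le> f b" if "b \<in> box N" for b
    using that unfolding f_def box_def by simp
  have f_le: "f b \<le> 4 * (real N)\<^sup>2" if "b \<in> box N" for b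
  proof -
    have "(int N - 1 - b) * (int N - b) \<le> (2 * int N) * (2 * int N)"
      by (rule mult_mono) (use that in \<open>auto simp: box_def\<close>)
    then have "f b \<le> real_of_int ((2 * int N) * (2 * int N))"
      unfolding f_def using of_int_le_iff by blast
    then show ?thesis by (simp add: power2_eq_square)
  qed
  \<comment> \<open>Over \<open>16 * N^2\<close> steps the drift adds
    \<open>8 * N^2 * \<mu>\<close>, twice the upper bound for the final \<open>F\<close>; the
    surplus must be absorbed at the left end.\<close>
  define L where "L = 16 * N\<^sup>2"
  have "F L \<le> (\<Sum>b\<in>box N. u L b * (4 * (real N)\<^sup>2))"
    unfolding F_def by (intro sum_mono mult_left_mono f_le u_nonneg)
  also have "\<dots> = \<mu> * (4 * (real N)\<^sup>2)"
    by (simp only: sum_distrib_right[symmetric] u_sum)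
  finally have FL: "F L \<le> \<mu> * (4 * (real N)\<^sup>2)" .
  have F0: "0 \<le> F 0" unfolding F_def by (intro sum_nonneg mult_nonneg_nonneg u_nonneg f_nonneg)
  have "real L * \<mu> / 2 - \<mu> * (4 * (real N)\<^sup>2) \<le> real N * (\<Sum>i<L. u i (- int N))"
    using sum_F[of L] FL F0 by linarith
  also have "\<dots> \<le> real N * (\<Sum>i<L. u L (- int N))"
    using lift_Suc_mono_le[of "\<lambda>l. u l (- int N)", OF left_inc]
    by (intro sum_mono mult_left_mono) auto
  finally have "real L * \<mu> / 2 - \<mu> * (4 * (real N)\<^sup>2) \<le> real N * (real L * u L (- int N))"
    by simp
  moreover have "real L = 16 * (real N)\<^sup>2" by (simp add: L_def)
  ultimately have "4 * (real N)\<^sup>2 * \<mu> \<le> real N * (16 * (real N)\<^sup>2 * u L (- int N))"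
    by simp
  then have "4 * (real N)\<^sup>2 * \<mu> \<le> 4 * (real N)\<^sup>2 * (4 * real N * u L (- int N))"
    by (simp add: algebra_simps)
  then have "\<mu> \<le> 4 * real N * u L (- int N)"
    using N by (subst (asm) mult_le_cancel_left_pos) auto
  then show ?thesis using N unfolding u_def L_def \<mu>_def by (simp add: field_simps)
qed

definition marginal :: "nat \<Rightarrow> nat \<Rightarrow> int \<Rightarrow> real" where
  "marginal N l b = (\<Sum>a\<in>box N. walk N l a b)"

text \<open>Summed over \<open>a\<close>, the moves of the first coordinate preserve the total by
  self-adjointness, so the marginal evolves on its own.\<close>

lemma marginal_Suc:
  assumes "N \<ge> 1"
  shows "marginal N (Suc l) = lazy N (marginal N l)"
proof
  fix b
  have "(\<Sum>a\<in>box N. walk N l (clamp N (a - 1)) b + walk N l (clamp N (a + 1)) b)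
      = 2 * (\<Sum>a\<in>box N. walk N l a b)"
    using clamp_selfadjoint[OF assms, of "\<lambda>a. walk N l a b" "\<lambda>_. 1"]
    by (simp add: sum_distrib_right[symmetric])
  then show "marginal N (Suc l) b = lazy N (marginal N l) b"
    by (simp add: marginal_def lazy_def sum.distrib sum_divide_distrib[symmetric] add_divide_distrib)
qed

lemma marginal_0:
  assumes "N \<ge> 1"
  shows "marginal N 0 b = (if int N - 1 \<le> b then 1 else 0)"
proof -
  have "marginal N 0 b = (\<Sum>a\<in>box N. if a = int N - 1 then (if int N - 1 \<le> b then 1 else 0) else 0)"
    unfolding marginal_def by (intro sum.cong) (auto simp: box_def)
  then show ?thesis using assms by (simp add: box_def)
qed

lemma marginal_mono: "mono (marginal N l)"
  unfolding mono_def marginal_def by (auto intro!: sum_mono walk_mono)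

lemma marginal_nonneg: "0 \<le> marginal N l b"
  unfolding marginal_def by (intro sum_nonneg walk_nonneg)

lemma sum_marginal:
  assumes "N \<ge> 1"
  shows "(\<Sum>b\<in>box N. marginal N l b) = 1"
proof (induction l)
  case 0
  have "(\<Sum>b\<in>box N. marginal N 0 b) = (\<Sum>b\<in>box N. if b = int N - 1 then 1 else 0)"
    by (intro sum.cong) (auto simp: marginal_0[OF assms], auto simp: box_def)
  then show ?case using assms by (simp add: box_def)
qed (simp add: marginal_Suc[OF assms] sum_lazy[OF assms])

lemma marginal_left_end_ge:
  assumes N: "N \<ge> 1"
  shows "1 / (4 * real N) \<le> marginal N (16 * N\<^sup>2) (- int N)"
proof -
  have eq: "marginal N l = (lazy N ^^ l) (marginal N 0)" for l
    by (induction l) (simp_all add: marginal_Suc[OF N])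
  show ?thesis
    using lazy_left_end_ge[OF N marginal_mono marginal_nonneg, of N 0]
    unfolding eq[of "16 * N\<^sup>2"] sum_marginal[OF N] .
qed

text \<open>The coordinates are treated in turn by \<open>lazy_left_end_ge\<close>, each time at the
  price of \<open>16 * N^2\<close> steps and a factor \<open>4 * N\<close>: first the marginal at
  the left end, then the row with first coordinate \<open>- N\<close>.\<close>

lemma walk_left_corner_ge:
  assumes N: "N \<ge> 1"
  shows "1 / (16 * (real N)\<^sup>2) \<le> walk N (32 * N\<^sup>2) (- int N) (- int N)"
proof -
  define M where "M = 16 * N\<^sup>2"
  \<comment> \<open>With the first coordinate at the left end, moving it cannot lower the value, by
    monotonicity. Replacing the move by a pause leaves the lazy walk as a lower bound.\<close>
  have ge: "(lazy N ^^ l) (walk N M (- int N)) b \<le> walk N (M + l) (- int N) b" for l b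
  proof (induction l arbitrary: b)
    case (Suc l)
    have "(lazy N ^^ Suc l) (walk N M (- int N)) b \<le> lazy N (walk N (M + l) (- int N)) b"
      using Suc by (auto intro: lazy_le)
    also have "\<dots> \<le> walk N (M + Suc l) (- int N) b"
    proof -
      have "walk N (M + l) (- int N) b \<le> walk N (M + l) (clamp N x) b" for x
        by (intro walk_mono clamp_ge) auto
      moreover have "x / 2 + (v + w) / 4 \<le> (y + z + v + w) / 4" if "x \<le> y" "x \<le> z" for v w x y z :: real
        using that by (simp add: field_simps)
      ultimately show ?thesis unfolding lazy_def walk.simps add_Suc_right by blast
    qed
    finally show ?case .
  qed auto
  have "1 / (4 * real N) \<le> marginal N M (- int N)"
    using marginal_left_end_ge[OF N] by (simp add: M_def)
  also have "\<dots> = (\<Sum>b\<in>box N. walk N M (- int N) b)"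
    unfolding marginal_def by (intro sum.cong refl walk_sym)
  finally have "1 / (4 * real N) / (4 * real N) \<le> (\<Sum>b\<in>box N. walk N M (- int N) b) / (4 * real N)"
    by (intro divide_right_mono) auto
  also have "\<dots> \<le> (lazy N ^^ (16 * N\<^sup>2)) (walk N M (- int N)) (- int N)"
    by (intro lazy_left_end_ge[OF N]) (auto simp: mono_def walk_nonneg intro: walk_mono)
  also have "\<dots> \<le> walk N (M + 16 * N\<^sup>2) (- int N) (- int N)" by (rule ge)
  finally show ?thesis by (simp add: M_def power2_eq_square)
qed

text \<open>Mass at the right end lowers \<open>F\<close> at rate \<open>N\<close>, and
  \<open>F\<close> otherwise grows by 1/2 per step. As \<open>F\<close> starts at most at
  \<open>4 * N^2\<close> and stays nonnegative, the total mass times \<open>N\<close> is at most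
  \<open>4 * N^2 + 16 * N^2\<close>.\<close>

lemma sum_marginal_right_end_le:
  assumes N: "N \<ge> 1"
  shows "(\<Sum>l<32 * N\<^sup>2. marginal N l (int N - 1)) \<le> 20 * real N"
proof -
  define f where "f b = real_of_int ((b + int N) * (b + int N + 1))" for b
  define F where "F l = (\<Sum>b\<in>box N. marginal N l b * f b)" for l
  have t: "int N - 1 \<in> box N" using N by (auto simp: box_def)
  have F_Suc: "F (Suc l) = F l + 1 / 2 - real N * marginal N l (int N - 1)" for l
  proof -
    have "F (Suc l) = (\<Sum>b\<in>box N. marginal N l b * lazy N f b)"
      by (simp add: F_def marginal_Suc[OF N] sum_lazy_mult[OF N])
    also have "\<dots> = (\<Sum>b\<in>box N. marginal N l b * f b + marginal N l b / 2
        - (if b = int N - 1 then real N * marginal N l b else 0))"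
      unfolding f_def by (intro sum.cong refl, subst lazy_quadratic_right[OF N]) (auto simp: algebra_simps)
    also have "\<dots> = F l + 1 / 2 - real N * marginal N l (int N - 1)"
      using t by (simp add: sum.distrib sum_subtractf F_def sum_divide_distrib[symmetric] sum_marginal[OF N])
    finally show ?thesis .
  qed
  have sum_F: "F l = F 0 + real l / 2 - real N * (\<Sum>i<l. marginal N i (int N - 1))" for l
    by (induction l) (auto simp: F_Suc algebra_simps add_divide_distrib)
  have F_nonneg: "0 \<le> F l" for l
    unfolding F_def f_def by (intro sum_nonneg mult_nonneg_nonneg marginal_nonneg) (auto simp: box_def)
  have "F 0 = (\<Sum>b\<in>box N. if b = int N - 1 then f b else 0)"
    unfolding F_def by (intro sum.cong) (auto simp: marginal_0[OF N], auto simp: box_def)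
  also have "\<dots> = (2 * real N - 1) * (2 * real N)" using t by (simp add: f_def)
  also have "\<dots> \<le> 4 * (real N)\<^sup>2" by (simp add: algebra_simps power2_eq_square)
  finally have "real N * (\<Sum>i<32 * N\<^sup>2. marginal N i (int N - 1)) \<le> 20 * (real N)\<^sup>2"
    using sum_F[of "32 * N\<^sup>2"] F_nonneg[of "32 * N\<^sup>2"] by simp
  also have "\<dots> = real N * (20 * real N)" by (simp add: power2_eq_square)
  finally show ?thesis using N by simp
qed

section \<open>The Green function up to time \<open>32 * N^2\<close>\<close>

definition green :: "nat \<Rightarrow> int \<Rightarrow> int \<Rightarrow> real" where
  "green N a b = (\<Sum>l<32 * N\<^sup>2. walk N l a b)"

lemma green_nonneg: "0 \<le> green N a b"
  unfolding green_def by (intro sum_nonneg walk_nonneg)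

lemma green_sym: "green N a b = green N b a"
  unfolding green_def by (intro sum.cong refl walk_sym)

lemma green_mono: "a \<le> a' \<Longrightarrow> b \<le> b' \<Longrightarrow> green N a b \<le> green N a' b'"
  unfolding green_def by (intro sum_mono walk_mono)

text \<open>One step of the walk shifts the time index by one, so the sum over time
  telescopes.\<close>

lemma green_laplacian:
  "(green N (clamp N (a - 1)) b + green N (clamp N (a + 1)) b
     + green N a (clamp N (b - 1)) + green N a (clamp N (b + 1))) / 4 - green N a b
   = walk N (32 * N\<^sup>2) a b - walk N 0 a b"
proof -
  have "(\<Sum>l<32 * N\<^sup>2. walk N (Suc l) a b - walk N l a b) = walk N (32 * N\<^sup>2) a b - walk N 0 a b"
    by (rule sum_lessThan_telescope)
  then show ?thesis
    by (simp add: green_def sum.distrib sum_subtractf sum_divide_distrib[symmetric] del: walk.simps(1))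
qed

lemma sum_green_le:
  assumes N: "N \<ge> 1" and "A \<subseteq> box N" "b \<le> int N - 1"
  shows "(\<Sum>a\<in>A. green N a b) \<le> 20 * real N"
proof -
  have "(\<Sum>a\<in>A. green N a b) \<le> (\<Sum>a\<in>box N. green N a b)"
    using assms by (intro sum_mono2 green_nonneg) auto
  also have "\<dots> = (\<Sum>l<32 * N\<^sup>2. marginal N l b)"
    unfolding green_def marginal_def by (rule sum.swap)
  also have "\<dots> \<le> (\<Sum>l<32 * N\<^sup>2. marginal N l (int N - 1))"
    using marginal_mono assms by (intro sum_mono) (auto simp: mono_def)
  also have "\<dots> \<le> 20 * real N" by (rule sum_marginal_right_end_le[OF N])
  finally show ?thesis .
qed

text \<open>The left side telescopes in time, by the equations for the walk and its marginal at the
  right end, and is at most \<open>2 - 2 * 2\<^sup>-\<^sup>L\<close>; this is bounded by the right side, whose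
  \<open>l\<close>-th increment is at least \<open>2\<^sup>-\<^sup>l\<close>.\<close>
lemma green_corner_ge:
  assumes N: "N \<ge> 1"
  shows "(\<Sum>y\<in>{- int N .. int N - 2}. green N y (int N - 1) - green N y (int N - 2))
     \<le> green N (int N - 1) (int N - 1) - green N (- int N) (- int N)"
proof -
  define t where "t = int N - 1"
  define e where "e = - int N"
  define r where "r l = walk N l t t" for l
  define D where "D l = r l - walk N l e e" for l
  define m where "m l = marginal N l t" for l
  have et: "e < t" using N by (simp add: e_def t_def)
  have ct: "clamp N (t + 1) = t" "clamp N (t - 1) = t - 1" "clamp N (e + 1) = e + 1" "clamp N (e - 1) = e"
    using N by (auto simp: clamp_def t_def e_def)
  have r_Suc: "r (Suc l) = r l / 2 + walk N l t (t - 1) / 2" for l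
    using walk_sym[of N l "t - 1" t] by (simp add: r_def ct)
  have e_Suc: "walk N (Suc l) e e = walk N l e e / 2 + walk N l e (e + 1) / 2" for l
    using walk_sym[of N l "e + 1" e] by (simp add: ct)
  have D: "(1/2) ^ l \<le> D l" for l
  proof (induction l)
    case 0
    show ?case using et by (simp add: D_def r_def, auto simp: t_def e_def)
  next
    case (Suc l)
    \<comment> \<open>In a box of two points \<open>e + 1\<close> equals \<open>t\<close>, and
      symmetry replaces monotonicity.\<close>
    have "walk N l e (e + 1) \<le> walk N l t (t - 1)"
      using walk_sym[of N l e "e + 1"] et
      by (cases "e + 1 = t") (auto intro!: walk_mono)
    then have "D l / 2 \<le> D (Suc l)" unfolding D_def r_Suc e_Suc by simp
    then show ?case using Suc by simp
  qed
  have "2 * (1 - (1/2) ^ L) \<le> (\<Sum>l<L. D l)" for L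
  proof (induction L)
    case (Suc L)
    then show ?case using D[of L] by simp
  qed simp
  moreover have "m (Suc l) = m l + (marginal N l (t - 1) - m l) / 4" for l
    by (simp add: m_def marginal_Suc[OF N] lazy_def ct) (simp add: field_simps)
  \<comment> \<open>The inner sum is \<open>- 4 * (m (Suc l) - m l) + 2 * (r (Suc l) - r l)\<close>;
    the constant 2 fits \<open>m 0 = r 0 = 1\<close>.\<close>
  then have "(\<Sum>l<L. \<Sum>y\<in>{e..t - 1}. walk N l y t - walk N l y (t - 1))
      = 2 - 4 * m L + 2 * r L" for L
  proof (induction L)
    case 0
    then show ?case using marginal_0[OF N, of t] by (simp add: m_def r_def) (simp add: t_def)
  next
    case (Suc L)
    have b: "box N = insert t {e..t - 1}" using et by (auto simp: box_def t_def e_def)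
    have "(\<Sum>y\<in>{e..t - 1}. walk N L y t - walk N L y (t - 1))
        = m L - marginal N L (t - 1) - (r L - walk N L t (t - 1))"
      by (simp add: m_def marginal_def b sum_subtractf r_def)
    then show ?case using Suc by (simp add: r_Suc field_simps)
  qed
  moreover have "r L \<le> m L" for L
    unfolding r_def m_def marginal_def
    by (rule member_le_sum[of t "box N" "\<lambda>a. walk N L a t"]) (use et in \<open>auto simp: box_def t_def e_def walk_nonneg\<close>)
  moreover have "(1/2) ^ L \<le> r L" for L
    using D[of L] walk_nonneg[of N L e e] by (simp add: D_def)
  ultimately have "(\<Sum>l<L. \<Sum>y\<in>{e..t - 1}. walk N l y t - walk N l y (t - 1)) \<le> (\<Sum>l<L. D l)" for L
    by (smt (verit, best))
  from this[of "32 * N\<^sup>2"] show ?thesis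
    unfolding green_def D_def r_def sum_subtractf[symmetric] t_def e_def
    by (subst (asm) sum.swap) (simp add: algebra_simps)
qed

section \<open>A Lyapunov function for the second class particle\<close>

definition sites :: "nat \<Rightarrow> int set" where
  "sites N = {- int N .. int N}"

text \<open>Decreasing the larger coordinate by one removes the exclusion constraint, and turns an
  unlabelled pair of exclusion particles into an unlabelled pair of independent walks.\<close>
definition pair_green :: "nat \<Rightarrow> int \<Rightarrow> int \<Rightarrow> real" where
  "pair_green N y z = green N (min y z) (max y z - 1)"

lemma finite_sites [simp]: "finite (sites N)"
  by (simp add: sites_def)

lemma pair_green_sym: "pair_green N y z = pair_green N z y"
  by (simp add: pair_green_def min.commute max.commute)

lemma pair_green_nonneg: "0 \<le> pair_green N y z"
  by (simp add: pair_green_def green_nonneg)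

lemma transpose_sites: "x \<in> box N \<Longrightarrow> y \<in> sites N \<Longrightarrow> transpose x (x + 1) y \<in> sites N"
  by (auto simp: transpose_def box_def sites_def)

text \<open>For \<open>y + 1 < z\<close> the bonds at the two particles reproduce the four moves of
  the walk at \<open>(y, z - 1)\<close>, away from the corner. For neighbours this point lies on the
  diagonal: exchanging them changes nothing, and by symmetry the two outer bonds carry half of the
  Laplacian, which leaves coefficient 1.\<close>

lemma pair_green_exclusion_less:
  fixes y z :: int
  assumes N: "N \<ge> 1" and yz: "y \<in> sites N" "z \<in> sites N" "y < z"
  shows "walk N (32 * N\<^sup>2) (- int N) (- int N) - of_bool (y = int N - 1 \<and> z = int N)
    \<le> (\<Sum>x\<in>box N. pair_green N (transpose x (x + 1) y) (transpose x (x + 1) z) - pair_green N y z) / 2"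
proof -
  define T where "T x = pair_green N (transpose x (x + 1) y) (transpose x (x + 1) z) - pair_green N y z" for x
  define g where "g = green N"
  define w where "w = walk N (32 * N\<^sup>2)"
  define X where "X = {y - 1, y, z - 1, z}"
  have "(\<Sum>x\<in>box N. T x) = (\<Sum>x\<in>box N \<inter> X. T x)"
    by (rule sum.mono_neutral_right) (auto simp: T_def X_def transpose_def)
  also have "\<dots> = (\<Sum>x\<in>X. if x \<in> box N then T x else 0)"
    by (simp add: sum.inter_restrict[symmetric] Int_commute X_def)
  finally have sum_T: "(\<Sum>x\<in>box N. T x) = (\<Sum>x\<in>X. if x \<in> box N then T x else 0)" .
  have w_ge: "w (- int N) (- int N) \<le> w y (z - 1)"
    unfolding w_def by (rule walk_mono) (use yz in \<open>auto simp: sites_def\<close>)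
  have w_nonneg: "0 \<le> w (- int N) (- int N)" by (simp add: w_def walk_nonneg)
  have lap: "(g (clamp N (y - 1)) (z - 1) + g (clamp N (y + 1)) (z - 1)
     + g y (clamp N (z - 1 - 1)) + g y (clamp N (z - 1 + 1))) / 4 - g y (z - 1)
     = w y (z - 1) - walk N 0 y (z - 1)"
    unfolding g_def w_def by (rule green_laplacian)
  \<comment> \<open>At the border the bond is missing, and there the clamp makes the difference
    vanish.\<close>
  have left: "(if y - 1 \<in> box N then T (y - 1) else 0) = g (clamp N (y - 1)) (z - 1) - g y (z - 1)"
    using yz by (auto simp: T_def g_def box_def sites_def clamp_def pair_green_def transpose_def)
  have right: "(if z \<in> box N then T z else 0) = g y (clamp N (z - 1 + 1)) - g y (z - 1)"
    using yz by (auto simp: T_def g_def box_def sites_def clamp_def pair_green_def transpose_def)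
  show ?thesis
  proof (cases "z = y + 1")
    case True
    have "T y = 0"
      using True by (simp add: T_def pair_green_sym transpose_def)
    moreover have "X = {y - 1, y, z}" using True by (auto simp: X_def)
    ultimately have "(\<Sum>x\<in>box N. T x)
        = g (clamp N (y - 1)) (z - 1) - g y (z - 1) + (g y (clamp N (z - 1 + 1)) - g y (z - 1))"
      unfolding sum_T left[symmetric] right[symmetric] using True by simp
    also have "\<dots> = 2 * (w y (z - 1) - walk N 0 y (z - 1))"
      using lap True green_sym[of N "clamp N (y - 1)" y] green_sym[of N "clamp N (y + 1)" y]
      by (simp add: g_def field_simps del: walk.simps)
    finally show ?thesis
      using w_ge True yz unfolding T_def[symmetric] w_def[symmetric] by (auto simp: sites_def)
  next
    case False
    then have "y + 1 < z" using yz by simp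
    then have mid: "(if y \<in> box N then T y else 0) = g (clamp N (y + 1)) (z - 1) - g y (z - 1)"
      "(if z - 1 \<in> box N then T (z - 1) else 0) = g y (clamp N (z - 1 - 1)) - g y (z - 1)"
      using yz by (auto simp: T_def g_def box_def sites_def clamp_def pair_green_def transpose_def)
    have "(\<Sum>x\<in>box N. T x) = 4 * (w y (z - 1) - walk N 0 y (z - 1))"
      using \<open>y + 1 < z\<close> unfolding sum_T X_def lap[symmetric] by (simp add: left right mid del: walk.simps)
    also have "walk N 0 y (z - 1) = 0" using \<open>y + 1 < z\<close> yz by (auto simp: sites_def)
    finally show ?thesis
      using w_ge w_nonneg False unfolding T_def[symmetric] w_def[symmetric] by auto
  qed
qed

lemma pair_green_exclusion:
  fixes y z :: int
  assumes N: "N \<ge> 1" and yz: "y \<in> sites N" "z \<in> sites N" "y \<noteq> z"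
  shows "walk N (32 * N\<^sup>2) (- int N) (- int N) - of_bool ({y, z} = {int N - 1, int N})
    \<le> (\<Sum>x\<in>box N. pair_green N (transpose x (x + 1) y) (transpose x (x + 1) z) - pair_green N y z) / 2"
proof (cases "y < z")
  case True
  then have "{y, z} = {int N - 1, int N} \<longleftrightarrow> y = int N - 1 \<and> z = int N"
    by (auto simp: doubleton_eq_iff)
  then show ?thesis using pair_green_exclusion_less[OF N yz(1,2) True] by simp
next
  case False
  then have less: "z < y" using yz by simp
  then have "{y, z} = {int N - 1, int N} \<longleftrightarrow> z = int N - 1 \<and> y = int N"
    by (auto simp: doubleton_eq_iff)
  then show ?thesis using pair_green_exclusion_less[OF N yz(2,1) less]
    by (simp add: pair_green_sym[of N y] pair_green_sym[of N "transpose _ _ y"])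
qed

lemma uminus_transpose:
  fixes x y :: int
  shows "- transpose x (x + 1) y = transpose (- x - 1) (- x - 1 + 1) (- y)"
  by (auto simp: transpose_def)

text \<open>Reflection sends the bond at \<open>x\<close> to the bond at \<open>- x - 1\<close>,
  which carries the estimate over to the left corner.\<close>

lemma pair_green_exclusion_reflected:
  fixes y z :: int
  assumes N: "N \<ge> 1" and yz: "y \<in> sites N" "z \<in> sites N" "y \<noteq> z"
  shows "walk N (32 * N\<^sup>2) (- int N) (- int N) - of_bool ({y, z} = {- int N, - int N + 1})
    \<le> (\<Sum>x\<in>box N. pair_green N (- transpose x (x + 1) y) (- transpose x (x + 1) z)
          - pair_green N (- y) (- z)) / 2"
proof -
  have "{- y, - z} = {int N - 1, int N} \<longleftrightarrow> {y, z} = {- int N, - int N + 1}"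
    by (auto simp: doubleton_eq_iff)
  moreover have "(\<Sum>x\<in>box N. pair_green N (- transpose x (x + 1) y) (- transpose x (x + 1) z)
          - pair_green N (- y) (- z))
    = (\<Sum>x\<in>box N. pair_green N (transpose x (x + 1) (- y)) (transpose x (x + 1) (- z))
          - pair_green N (- y) (- z))"
    by (rule sum.reindex_bij_witness[of _ "\<lambda>x. - x - 1" "\<lambda>x. - x - 1"])
      (auto simp: box_def uminus_transpose[of _ y] uminus_transpose[of _ z])
  ultimately show ?thesis
    using pair_green_exclusion[of N "- y" "- z"] assms by (simp add: sites_def)
qed

text \<open>The configuration \<open>\<eta>\<close> carries a second class particle at \<open>z \<notin> \<eta>\<close>; particles
  help to kill it at the right end, holes at the left end.\<close>
definition potential :: "nat \<Rightarrow> int set \<Rightarrow> int \<Rightarrow> real" where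
  "potential N \<eta> z = (\<Sum>y\<in>sites N - {z}. if y \<in> \<eta> then pair_green N y z else pair_green N (- y) (- z))"

definition dies_right :: "nat \<Rightarrow> int set \<Rightarrow> int \<Rightarrow> bool" where
  "dies_right N \<eta> z \<longleftrightarrow> z = int N \<and> int N - 1 \<in> \<eta> \<or> z = int N - 1 \<and> int N \<in> \<eta>"

definition dies_left :: "nat \<Rightarrow> int set \<Rightarrow> int \<Rightarrow> bool" where
  "dies_left N \<eta> z \<longleftrightarrow> z = - int N \<and> - int N + 1 \<notin> \<eta> \<or> z = - int N + 1 \<and> - int N \<notin> \<eta>"

lemma potential_nonneg: "0 \<le> potential N \<eta> z"
  unfolding potential_def by (intro sum_nonneg) (auto intro: pair_green_nonneg)

text \<open>The sites on either side of \<open>z\<close> run through part of one row of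
  \<open>green\<close>, with the other coordinate fixed at \<open>z - 1\<close> or at
  \<open>z\<close>; each row costs at most \<open>20 * N\<close>.\<close>

lemma sum_pair_green_le:
  assumes N: "N \<ge> 1" and z: "z \<in> sites N"
  shows "(\<Sum>y\<in>sites N - {z}. pair_green N y z) \<le> 40 * real N"
proof -
  have "sites N - {z} = {- int N .. z - 1} \<union> {z + 1 .. int N}" using z by (auto simp: sites_def)
  then have "(\<Sum>y\<in>sites N - {z}. pair_green N y z)
      = (\<Sum>y\<in>{- int N .. z - 1}. pair_green N y z) + (\<Sum>y\<in>{z + 1 .. int N}. pair_green N y z)"
    by (simp add: sum.union_disjoint)
  also have "(\<Sum>y\<in>{- int N .. z - 1}. pair_green N y z) = (\<Sum>y\<in>{- int N .. z - 1}. green N y (z - 1))"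
    by (intro sum.cong) (auto simp: pair_green_def)
  also have "(\<Sum>y\<in>{z + 1 .. int N}. pair_green N y z) = (\<Sum>y\<in>{z .. int N - 1}. green N y z)"
    by (rule sum.reindex_bij_witness[of _ "\<lambda>y. y + 1" "\<lambda>y. y - 1"])
      (auto simp: pair_green_def green_sym[of N z])
  also have "(\<Sum>y\<in>{- int N .. z - 1}. green N y (z - 1)) + (\<Sum>y\<in>{z .. int N - 1}. green N y z)
      \<le> 20 * real N + 20 * real N"
  proof (intro add_mono)
    show "(\<Sum>y\<in>{- int N .. z - 1}. green N y (z - 1)) \<le> 20 * real N"
      by (rule sum_green_le[OF N]) (use z in \<open>auto simp: sites_def box_def\<close>)
    show "(\<Sum>y\<in>{z .. int N - 1}. green N y z) \<le> 20 * real N"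
    proof (cases "z = int N")
      case False
      show ?thesis by (rule sum_green_le[OF N]) (use z False in \<open>auto simp: sites_def box_def\<close>)
    qed simp
  qed
  finally show ?thesis by simp
qed

lemma potential_le:
  assumes N: "N \<ge> 1" and z: "z \<in> sites N"
  shows "potential N \<eta> z \<le> 80 * real N"
proof -
  have "potential N \<eta> z \<le> (\<Sum>y\<in>sites N - {z}. pair_green N y z + pair_green N (- y) (- z))"
    unfolding potential_def by (intro sum_mono) (auto simp: pair_green_nonneg)
  also have "\<dots> = (\<Sum>y\<in>sites N - {z}. pair_green N y z) + (\<Sum>y\<in>sites N - {z}. pair_green N (- y) (- z))"
    by (rule sum.distrib)
  also have "(\<Sum>y\<in>sites N - {z}. pair_green N (- y) (- z)) = (\<Sum>y\<in>sites N - {- z}. pair_green N y (- z))"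
    by (rule sum.reindex_bij_witness[of _ uminus uminus]) (auto simp: sites_def)
  also have "(\<Sum>y\<in>sites N - {z}. pair_green N y z) + \<dots> \<le> 40 * real N + 40 * real N"
    using z by (intro add_mono sum_pair_green_le N) (auto simp: sites_def)
  finally show ?thesis by simp
qed

lemma mem_swap_iff: "y \<in> swap \<eta> x \<longleftrightarrow> transpose x (x + 1) y \<in> \<eta>"
  by (auto simp: swap_def transpose_def)

text \<open>Following each site through the exchange makes the sum comparable term by term with the
  one before it.\<close>

lemma potential_swap:
  assumes x: "x \<in> box N"
  shows "potential N (swap \<eta> x) (transpose x (x + 1) z)
    = (\<Sum>y\<in>sites N - {z}. if y \<in> \<eta> then pair_green N (transpose x (x + 1) y) (transpose x (x + 1) z)
         else pair_green N (- transpose x (x + 1) y) (- transpose x (x + 1) z))"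
  unfolding potential_def
  by (rule sum.reindex_bij_witness[of _ "transpose x (x + 1)" "transpose x (x + 1)"])
    (auto simp: mem_swap_iff transpose_sites[OF x] transpose_eq_iff)

text \<open>Each of the \<open>2 * N\<close> other sites contributes, as a particle or as a hole. At
  either end at most one of them forms the corner pair that costs 1, and only when a death is
  possible there.\<close>

lemma potential_swap_gain:
  assumes N: "N \<ge> 1" and z: "z \<in> sites N" 
  shows "2 * real N * walk N (32 * N\<^sup>2) (- int N) (- int N)
      - of_bool (dies_right N \<eta> z) - of_bool (dies_left N \<eta> z)
    \<le> (\<Sum>x\<in>box N. potential N (swap \<eta> x) (transpose x (x + 1) z) - potential N \<eta> z) / 2"
proof -
  define w where "w = walk N (32 * N\<^sup>2) (- int N) (- int N)"
  define h where "h x y = (if y \<in> \<eta> then pair_green N (transpose x (x + 1) y) (transpose x (x + 1) z)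
         else pair_green N (- transpose x (x + 1) y) (- transpose x (x + 1) z))
       - (if y \<in> \<eta> then pair_green N y z else pair_green N (- y) (- z))" for x y
  have R: "(\<Sum>y\<in>sites N - {z}. of_bool (y \<in> \<eta> \<and> {y, z} = {int N - 1, int N})) \<le> (of_bool (dies_right N \<eta> z) :: real)"
  proof -
    \<comment> \<open>The only candidate for a partner of \<open>z\<close> in the corner
      pair.\<close>
    define u where "u = (if z = int N then int N - 1 else int N)"
    have "(\<Sum>y\<in>sites N - {z}. of_bool (y \<in> \<eta> \<and> {y, z} = {int N - 1, int N}))
        \<le> (\<Sum>y\<in>sites N - {z}. if y = u then of_bool (dies_right N \<eta> z) else (0::real))"
      by (intro sum_mono) (auto simp: doubleton_eq_iff u_def dies_right_def split: if_splits)
    also have "\<dots> \<le> of_bool (dies_right N \<eta> z)" by (simp add: sum.delta)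
    finally show ?thesis .
  qed
  have L: "(\<Sum>y\<in>sites N - {z}. of_bool (y \<notin> \<eta> \<and> {y, z} = {- int N, - int N + 1})) \<le> (of_bool (dies_left N \<eta> z) :: real)"
  proof -
    define u where "u = (if z = - int N then - int N + 1 else - int N)"
    have "(\<Sum>y\<in>sites N - {z}. of_bool (y \<notin> \<eta> \<and> {y, z} = {- int N, - int N + 1}))
        \<le> (\<Sum>y\<in>sites N - {z}. if y = u then of_bool (dies_left N \<eta> z) else (0::real))"
      by (intro sum_mono) (auto simp: doubleton_eq_iff u_def dies_left_def split: if_splits)
    also have "\<dots> \<le> of_bool (dies_left N \<eta> z)" by (simp add: sum.delta)
    finally show ?thesis .
  qed
  have card: "card (sites N - {z}) = 2 * N" using z by (simp add: sites_def)
  have "2 * real N * w - of_bool (dies_right N \<eta> z) - of_bool (dies_left N \<eta> z)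
      \<le> (\<Sum>y\<in>sites N - {z}. w - of_bool (y \<in> \<eta> \<and> {y, z} = {int N - 1, int N})
           - of_bool (y \<notin> \<eta> \<and> {y, z} = {- int N, - int N + 1}))"
    using R L by (simp add: sum_subtractf card del: of_bool_eq_iff)
  also have "\<dots> \<le> (\<Sum>y\<in>sites N - {z}. (\<Sum>x\<in>box N. h x y) / 2)"
  proof (intro sum_mono)
    fix y assume "y \<in> sites N - {z}"
    then have y: "y \<in> sites N" "y \<noteq> z" by auto
    show "w - of_bool (y \<in> \<eta> \<and> {y, z} = {int N - 1, int N})
           - of_bool (y \<notin> \<eta> \<and> {y, z} = {- int N, - int N + 1}) \<le> (\<Sum>x\<in>box N. h x y) / 2"
      using pair_green_exclusion[OF N y(1) z y(2)] pair_green_exclusion_reflected[OF N y(1) z y(2)]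
      by (cases "y \<in> \<eta>") (simp_all add: h_def w_def)
  qed
  also have "\<dots> = (\<Sum>x\<in>box N. \<Sum>y\<in>sites N - {z}. h x y) / 2"
    by (subst sum.swap) (simp add: sum_divide_distrib)
  also have "(\<Sum>x\<in>box N. \<Sum>y\<in>sites N - {z}. h x y)
      = (\<Sum>x\<in>box N. potential N (swap \<eta> x) (transpose x (x + 1) z) - potential N \<eta> z)"
    by (intro sum.cong refl) (simp add: potential_swap potential_def[of N \<eta> z] h_def sum_subtractf)
  finally show ?thesis by (simp add: w_def)
qed

section \<open>Particle-hole duality and the boundary events\<close>

text \<open>Reflection combined with the exchange of particles and holes: it reverses inclusion and
  turns injections into removals.\<close>

definition dual :: "nat \<Rightarrow> int set \<Rightarrow> int set" where
  "dual N \<eta> = {y \<in> sites N. - y \<notin> \<eta>}"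

text \<open>As \<open>dual\<close> reverses inclusion, the lower configuration of the dual pair is
  the image of \<open>insert z \<eta>\<close>.\<close>

lemma potential_dual:
  assumes "z \<in> sites N"
  shows "potential N (dual N (insert z \<eta>)) (- z) = potential N \<eta> z"
  unfolding potential_def
  by (rule sum.reindex_bij_witness[of _ uminus uminus]) (use assms in \<open>auto simp: dual_def sites_def\<close>)

lemma potential_insert:
  assumes "y \<in> sites N" "y \<noteq> z" "y \<notin> \<eta>"
  shows "potential N (insert y \<eta>) z = potential N \<eta> z + (pair_green N y z - pair_green N (- y) (- z))"
proof -
  define A where "A = sites N - {z}"
  have A: "finite A" "y \<in> A" using assms by (auto simp: A_def)
  have "(\<Sum>u\<in>A - {y}. if u \<in> insert y \<eta> then pair_green N u z else pair_green N (- u) (- z))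
      = (\<Sum>u\<in>A - {y}. if u \<in> \<eta> then pair_green N u z else pair_green N (- u) (- z))"
    by (intro sum.cong) auto
  then show ?thesis
    using assms unfolding potential_def A_def[symmetric] sum.remove[OF A] by simp
qed

text \<open>When both end sites are full this is the identity, matching the vanishing rates.\<close>

definition inject :: "nat \<Rightarrow> int set \<Rightarrow> int set" where
  "inject N \<eta> = (if int N \<in> \<eta> then insert (int N - 1) \<eta> else insert (int N) \<eta>)"

text \<open>The only way in which an injection away from the second class particle lowers the
  potential: the hole at \<open>N - 1\<close> is filled while the second class particle sits at \<open>- N\<close>.\<close>
definition fill_cost :: "nat \<Rightarrow> real" where
  "fill_cost N = green N (- int N + 1) (int N - 1) - green N (- int N) (int N - 2)"

lemma fill_cost_nonneg: "0 \<le> fill_cost N"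
  by (simp add: fill_cost_def green_mono)

lemma fill_cost_le:
  assumes "N \<ge> 1"
  shows "fill_cost N \<le> 20 * real N"
  using sum_green_le[OF assms, of "{- int N + 1}" "int N - 1"] green_nonneg[of N "- int N" "int N - 2"] assms
  by (auto simp: fill_cost_def box_def)

text \<open>Filling a hole replaces its hole term by its particle term. Monotonicity of
  \<open>green\<close> orders the two when site \<open>N\<close> is filled, and also for site
  \<open>N - 1\<close> unless \<open>z = - N\<close>.\<close>

lemma potential_inject:
  assumes N: "N \<ge> 2" and z: "z \<in> sites N" "z \<noteq> int N" "z = int N - 1 \<longrightarrow> int N \<notin> \<eta>"
  shows "potential N \<eta> z - fill_cost N * of_bool (z = - int N \<and> int N \<in> \<eta>) \<le> potential N (inject N \<eta>) z"
proof (cases "int N \<in> \<eta>")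
  case True
  show ?thesis
  proof (cases "int N - 1 \<in> \<eta>")
    case True
    then show ?thesis
      using fill_cost_nonneg[of N] \<open>int N \<in> \<eta>\<close> by (auto simp: inject_def insert_absorb)
  next
    case False
    have eq: "potential N (inject N \<eta>) z = potential N \<eta> z
        + (pair_green N (int N - 1) z - pair_green N (- (int N - 1)) (- z))"
      using \<open>int N \<in> \<eta>\<close> unfolding inject_def
      by (simp del: minus_diff_eq) (rule potential_insert, use False N z \<open>int N \<in> \<eta>\<close> in \<open>auto simp: sites_def\<close>)
    have less: "z < int N - 1" using z \<open>int N \<in> \<eta>\<close> by (auto simp: sites_def)
    show ?thesis
    proof (cases "z = - int N")
      case True
      then show ?thesis unfolding eq using \<open>int N \<in> \<eta>\<close> N
        by (simp add: pair_green_def fill_cost_def min_def max_def algebra_simps)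
    next
      case False
      then have "pair_green N (- (int N - 1)) (- z) \<le> pair_green N (int N - 1) z"
        using z less unfolding pair_green_def by (intro green_mono) (auto simp: sites_def)
      then show ?thesis using eq False by simp
    qed
  qed
next
  case False
  have "pair_green N (- int N) (- z) \<le> pair_green N (int N) z"
    using z unfolding pair_green_def by (intro green_mono) (auto simp: sites_def)
  then show ?thesis
    using False z potential_insert[of "int N" N z \<eta>] by (auto simp: inject_def sites_def)
qed

text \<open>The two configurations are filled at \<open>N\<close> and at \<open>N - 1\<close>, so
  the second class particle steps back. Losses at the other sites are covered by
  \<open>green_corner_ge\<close>; a hole at \<open>- N\<close> leaves \<open>fill_cost\<close> to
  spare, which offsets the cost of a removal at the opposite end.\<close>

lemma potential_inject_right_end:
  assumes N: "N \<ge> 2" and \<eta>: "int N \<notin> \<eta>" "int N - 1 \<notin> \<eta>"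
  shows "potential N \<eta> (int N) + fill_cost N * of_bool (- int N \<notin> \<eta>)
     \<le> potential N (insert (int N) \<eta>) (int N - 1)"
proof -
  define S where "S = {- int N .. int N - 2}"
  define g where "g = green N"
  have S1: "sites N - {int N} = insert (int N - 1) S" and S2: "sites N - {int N - 1} = insert (int N) S"
    using N by (auto simp: sites_def S_def)
  define a where "a y = (if y \<in> \<eta> then g y (int N - 1) else g (- int N) (- y - 1))" for y
  define b where "b y = (if y \<in> \<eta> then g y (int N - 2) else g (- int N + 1) (- y - 1))" for y
  have A: "potential N \<eta> (int N) = g (- int N) (- int N) + (\<Sum>y\<in>S. a y)"
  proof -
    have "(\<Sum>y\<in>S. if y \<in> \<eta> then pair_green N y (int N) else pair_green N (- y) (- int N)) = (\<Sum>y\<in>S. a y)"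
      by (intro sum.cong) (auto simp: a_def g_def S_def pair_green_def min_def max_def)
    moreover have "int N - 1 \<notin> S" "finite S" by (auto simp: S_def)
    moreover have "pair_green N (- (int N - 1)) (- int N) = g (- int N) (- int N)"
      by (simp add: pair_green_def g_def)
    ultimately show ?thesis unfolding potential_def S1 using \<eta> by (simp del: minus_diff_eq)
  qed
  have B: "potential N (insert (int N) \<eta>) (int N - 1) = g (int N - 1) (int N - 1) + (\<Sum>y\<in>S. b y)"
  proof -
    have "(\<Sum>y\<in>S. if y \<in> insert (int N) \<eta> then pair_green N y (int N - 1)
        else pair_green N (- y) (- (int N - 1))) = (\<Sum>y\<in>S. b y)"
      by (intro sum.cong) (auto simp: b_def g_def S_def pair_green_def min_def max_def)
    moreover have "int N \<notin> S" "finite S" by (auto simp: S_def)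
    moreover have "pair_green N (int N) (int N - 1) = g (int N - 1) (int N - 1)"
      by (simp add: pair_green_def g_def)
    ultimately show ?thesis unfolding potential_def S2 using \<eta> by (simp del: minus_diff_eq)
  qed
  \<comment> \<open>Equality holds at particles and at a hole in \<open>- N\<close>; at any other
    hole the left term is nonpositive and the right one nonnegative.\<close>
  have "(\<Sum>y\<in>S. a y - b y) \<le> (\<Sum>y\<in>S. g y (int N - 1) - g y (int N - 2)
      - (if y = - int N then fill_cost N * of_bool (- int N \<notin> \<eta>) else 0))"
  proof (rule sum_mono)
    fix y assume "y \<in> S"
    have "g y (int N - 2) \<le> g y (int N - 1)" "g (- int N) (- y - 1) \<le> g (- int N + 1) (- y - 1)"
      unfolding g_def by (auto intro: green_mono)
    then show "a y - b y \<le> g y (int N - 1) - g y (int N - 2)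
      - (if y = - int N then fill_cost N * of_bool (- int N \<notin> \<eta>) else 0)"
      by (auto simp: a_def b_def fill_cost_def g_def)
  qed
  also have "\<dots> = (\<Sum>y\<in>S. g y (int N - 1) - g y (int N - 2)) - fill_cost N * of_bool (- int N \<notin> \<eta>)"
    using N by (simp add: sum_subtractf S_def)
  finally show ?thesis
    using green_corner_ge[of N] N unfolding A B by (simp add: sum_subtractf g_def S_def)
qed

section \<open>The drift of the Lyapunov function\<close>

definition lyap :: "nat \<Rightarrow> real \<Rightarrow> int set \<Rightarrow> int \<Rightarrow> real" where
  "lyap N \<epsilon> \<eta> z = 1 - \<epsilon> * potential N \<eta> z"

lemma lyap_dual:
  "z \<in> sites N \<Longrightarrow> lyap N \<epsilon> (dual N (insert z \<eta>)) (- z) = lyap N \<epsilon> \<eta> z"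
  by (simp add: lyap_def potential_dual)

text \<open>The value of \<open>lyap\<close> for the coupled pair after an injection, with 0 once
  the two have merged.\<close>

definition lyap_inject :: "nat \<Rightarrow> real \<Rightarrow> int set \<Rightarrow> int \<Rightarrow> real" where
  "lyap_inject N \<epsilon> \<eta> z =
    (if dies_right N \<eta> z then 0
     else if z = int N then lyap N \<epsilon> (insert (int N) \<eta>) (int N - 1)
     else lyap N \<epsilon> (inject N \<eta>) z)"

lemma lyap_inject_le:
  assumes N: "N \<ge> 2" and z: "z \<in> sites N" "z \<notin> \<eta>" and \<epsilon>: "0 \<le> \<epsilon>"
    and alive: "\<not> dies_right N \<eta> z"
  shows "lyap_inject N \<epsilon> \<eta> z \<le> lyap N \<epsilon> \<eta> z
     + \<epsilon> * fill_cost N * (of_bool (z = - int N \<and> int N \<in> \<eta>) - of_bool (z = int N \<and> - int N \<notin> \<eta>))"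
proof (cases "z = int N")
  case True
  then have "int N - 1 \<notin> \<eta>" using alive by (auto simp: dies_right_def)
  then have "potential N \<eta> (int N) + fill_cost N * of_bool (- int N \<notin> \<eta>)
     \<le> potential N (insert (int N) \<eta>) (int N - 1)"
    using potential_inject_right_end[OF N, of \<eta>] True z by auto
  from mult_left_mono[OF this \<epsilon>] show ?thesis
    using alive True N by (auto simp: lyap_inject_def lyap_def algebra_simps)
next
  case False
  then have "potential N \<eta> z - fill_cost N * of_bool (z = - int N \<and> int N \<in> \<eta>) \<le> potential N (inject N \<eta>) z"
    using potential_inject[OF N z(1), of \<eta>] alive by (auto simp: dies_right_def)
  from mult_left_mono[OF this \<epsilon>] show ?thesis
    using alive False by (auto simp: lyap_inject_def lyap_def algebra_simps)
qed

definition lyap_eject :: "nat \<Rightarrow> real \<Rightarrow> int set \<Rightarrow> int \<Rightarrow> real" where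
  "lyap_eject N \<epsilon> \<eta> z = lyap_inject N \<epsilon> (dual N (insert z \<eta>)) (- z)"

lemma dies_left_dual:
  "N \<ge> 2 \<Longrightarrow> dies_left N \<eta> z \<longleftrightarrow> dies_right N (dual N (insert z \<eta>)) (- z)"
  by (auto simp: dies_left_def dies_right_def dual_def sites_def)

text \<open>Duality interchanges the two indicators, so that they cancel when this bound is added to
  \<open>lyap_inject_le\<close>.\<close>

lemma lyap_eject_le:
  assumes N: "N \<ge> 2" and z: "z \<in> sites N" "z \<notin> \<eta>" and \<epsilon>: "0 \<le> \<epsilon>"
    and alive: "\<not> dies_left N \<eta> z"
  shows "lyap_eject N \<epsilon> \<eta> z \<le> lyap N \<epsilon> \<eta> z
     + \<epsilon> * fill_cost N * (of_bool (z = int N \<and> - int N \<notin> \<eta>) - of_bool (z = - int N \<and> int N \<in> \<eta>))"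
proof -
  have "lyap_eject N \<epsilon> \<eta> z \<le> lyap N \<epsilon> (dual N (insert z \<eta>)) (- z)
     + \<epsilon> * fill_cost N * (of_bool (- z = - int N \<and> int N \<in> dual N (insert z \<eta>))
          - of_bool (- z = int N \<and> - int N \<notin> dual N (insert z \<eta>)))"
    unfolding lyap_eject_def
    by (rule lyap_inject_le) (use N z \<epsilon> alive in \<open>auto simp: dies_left_dual dual_def sites_def\<close>)
  moreover have "- z = - int N \<and> int N \<in> dual N (insert z \<eta>) \<longleftrightarrow> z = int N \<and> - int N \<notin> \<eta>"
    using N by (auto simp: dual_def sites_def)
  moreover have "- z = int N \<and> - int N \<notin> dual N (insert z \<eta>) \<longleftrightarrow> z = - int N \<and> int N \<in> \<eta>"
    using N by (auto simp: dual_def sites_def)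
  ultimately show ?thesis by (simp only: lyap_dual[OF z(1)])
qed

lemma lyap_bounds:
  assumes N: "N \<ge> 1" and z: "z \<in> sites N" and \<epsilon>: "0 \<le> \<epsilon>" "\<epsilon> * (160 * real N) \<le> 1"
  shows "1 / 2 \<le> lyap N \<epsilon> \<eta> z" "lyap N \<epsilon> \<eta> z \<le> 1"
proof -
  have "\<epsilon> * potential N \<eta> z \<le> \<epsilon> * (80 * real N)"
    by (intro mult_left_mono potential_le N z \<epsilon>)
  then show "1 / 2 \<le> lyap N \<epsilon> \<eta> z" using \<epsilon> by (simp add: lyap_def)
  show "lyap N \<epsilon> \<eta> z \<le> 1" using \<epsilon> potential_nonneg by (simp add: lyap_def)
qed

text \<open>The costs of the two boundary events compensate each other, and a death pays for the
  negative terms of the bound on the exchange part.\<close>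
lemma lyap_boundary:
  assumes N: "N \<ge> 2" and z: "z \<in> sites N" "z \<notin> \<eta>" and j: "0 < j"
    and \<epsilon>: "0 \<le> \<epsilon>" "\<epsilon> * (160 * real N) \<le> 1" "\<epsilon> * (8 * real N) \<le> j"
  shows "j / (2 * real N) * (lyap_inject N \<epsilon> \<eta> z + lyap_eject N \<epsilon> \<eta> z - 2 * lyap N \<epsilon> \<eta> z)
     \<le> - \<epsilon> * (of_bool (dies_right N \<eta> z) + of_bool (dies_left N \<eta> z))"
proof -
  define v where "v = lyap N \<epsilon> \<eta> z"
  define c where "c = \<epsilon> * fill_cost N"
  have v: "1 / 2 \<le> v" using lyap_bounds(1)[of N z \<epsilon> \<eta>] N z \<epsilon> by (simp add: v_def)
  have "c \<le> \<epsilon> * (20 * real N)"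
    unfolding c_def using N by (intro mult_left_mono fill_cost_le \<epsilon>) auto
  then have c: "0 \<le> c" "c \<le> 1 / 4" using \<epsilon> fill_cost_nonneg by (auto simp: c_def)
  have not_both: "\<not> (dies_right N \<eta> z \<and> dies_left N \<eta> z)"
    using N by (auto simp: dies_right_def dies_left_def)
  \<comment> \<open>A death makes one term 0 and the other is at most \<open>v + c\<close>, so the
    bracket is at most \<open>c - v\<close>, hence at most -1/4. The third bound on \<epsilon> lets
    this outweigh \<epsilon> at rate \<open>j / (2 * N)\<close>.\<close>
  have death: "j / (2 * real N) * u \<le> - \<epsilon>" if "u \<le> - (1 / 4)" for u
  proof -
    have "j / (2 * real N) * u \<le> j / (2 * real N) * - (1 / 4)"
      using that j by (intro mult_left_mono) auto
    also have "\<dots> \<le> - \<epsilon>" using \<epsilon>(3) N by (simp add: field_simps)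
    finally show ?thesis .
  qed
  show ?thesis
  proof (cases "dies_right N \<eta> z")
    case True
    then have "lyap_eject N \<epsilon> \<eta> z \<le> v + c"
      using lyap_eject_le[OF N z \<epsilon>(1)] not_both c unfolding v_def c_def
      by (smt (verit) mult_left_le of_bool_def mult_nonneg_nonneg)
    moreover have "lyap_inject N \<epsilon> \<eta> z = 0" using True by (simp add: lyap_inject_def)
    ultimately show ?thesis using death[of "lyap_inject N \<epsilon> \<eta> z + lyap_eject N \<epsilon> \<eta> z - 2 * v"] v c True not_both
      by (simp add: v_def)
  next
    case right: False
    show ?thesis
    proof (cases "dies_left N \<eta> z")
      case True
      then have "lyap_inject N \<epsilon> \<eta> z \<le> v + c"
        using lyap_inject_le[OF N z \<epsilon>(1)] right c unfolding v_def c_def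
        by (smt (verit) mult_left_le of_bool_def mult_nonneg_nonneg)
      moreover have "lyap_eject N \<epsilon> \<eta> z = 0"
        using True N by (simp add: lyap_eject_def lyap_inject_def dies_left_dual)
      ultimately show ?thesis using death[of "lyap_inject N \<epsilon> \<eta> z + lyap_eject N \<epsilon> \<eta> z - 2 * v"] v c True right
        by (simp add: v_def)
    next
      case False
      have "lyap_inject N \<epsilon> \<eta> z + lyap_eject N \<epsilon> \<eta> z - 2 * lyap N \<epsilon> \<eta> z \<le> 0"
        using lyap_inject_le[OF N z \<epsilon>(1) right] lyap_eject_le[OF N z \<epsilon>(1) False]
        by (simp add: algebra_simps)
      then have "j / (2 * real N) * (lyap_inject N \<epsilon> \<eta> z + lyap_eject N \<epsilon> \<eta> z - 2 * lyap N \<epsilon> \<eta> z) \<le> 0"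
        using j by (intro mult_nonneg_nonpos) auto
      then show ?thesis using False right by simp
    qed
  qed
qed

text \<open>The deaths subtracted from the exchange gain cancel against
  \<open>lyap_boundary\<close>. The remaining gain, at least \<open>\<epsilon> / (8 * N)\<close>,
  gives a decay proportional to \<open>lyap\<close> because \<open>lyap\<close> is at most
  1.\<close>

lemma lyap_drift:
  assumes N: "N \<ge> 2" and z: "z \<in> sites N" "z \<notin> \<eta>" and j: "0 < j"
    and \<epsilon>: "0 \<le> \<epsilon>" "\<epsilon> * (160 * real N) \<le> 1" "\<epsilon> * (8 * real N) \<le> j"
  shows "(\<Sum>x\<in>box N. lyap N \<epsilon> (swap \<eta> x) (transpose x (x + 1) z)) / 2
      + j / (2 * real N) * (lyap_inject N \<epsilon> \<eta> z + lyap_eject N \<epsilon> \<eta> z)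
    \<le> (real N + j / real N - \<epsilon> / (8 * real N)) * lyap N \<epsilon> \<eta> z"
proof -
  define v where "v = lyap N \<epsilon> \<eta> z"
  define w where "w = walk N (32 * N\<^sup>2) (- int N) (- int N)"
  define d :: real where "d = of_bool (dies_right N \<eta> z) + of_bool (dies_left N \<eta> z)"
  have N1: "N \<ge> 1" using N by simp
  have v: "v \<le> 1" using lyap_bounds(2)[of N z \<epsilon> \<eta>] N z \<epsilon> by (simp add: v_def)
  have card: "card (box N) = 2 * N" by (simp add: box_def)
  have "1 / (16 * (real N)\<^sup>2) \<le> w" using walk_left_corner_ge[OF N1] by (simp add: w_def)
  then have "2 * real N * (1 / (16 * (real N)\<^sup>2)) \<le> 2 * real N * w" by (intro mult_left_mono) auto
  then have w: "1 / (8 * real N) \<le> 2 * real N * w" using N by (simp add: power2_eq_square field_simps)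
  have "2 * real N * w - d \<le> (\<Sum>x\<in>box N. potential N (swap \<eta> x) (transpose x (x + 1) z) - potential N \<eta> z) / 2"
    using potential_swap_gain[OF N1 z(1), of \<eta>] by (simp add: w_def d_def)
  with w have "1 / (8 * real N) - d
      \<le> (\<Sum>x\<in>box N. potential N (swap \<eta> x) (transpose x (x + 1) z) - potential N \<eta> z) / 2" by linarith
  from mult_left_mono[OF this \<epsilon>(1)]
  have "\<epsilon> / (8 * real N) - \<epsilon> * d
      \<le> \<epsilon> * ((\<Sum>x\<in>box N. potential N (swap \<eta> x) (transpose x (x + 1) z) - potential N \<eta> z) / 2)"
    by (simp add: algebra_simps)
  also have "\<dots> = real N * v - (\<Sum>x\<in>box N. lyap N \<epsilon> (swap \<eta> x) (transpose x (x + 1) z)) / 2"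
    by (simp add: v_def lyap_def sum_subtractf card sum_distrib_left[symmetric] algebra_simps diff_divide_distrib)
  finally have 1: "(\<Sum>x\<in>box N. lyap N \<epsilon> (swap \<eta> x) (transpose x (x + 1) z)) / 2
     \<le> real N * v - \<epsilon> / (8 * real N) + \<epsilon> * d" by linarith
  have 2: "j / (2 * real N) * (lyap_inject N \<epsilon> \<eta> z + lyap_eject N \<epsilon> \<eta> z - 2 * v) \<le> - (\<epsilon> * d)"
    using lyap_boundary[OF N z j \<epsilon>] by (simp add: v_def d_def)
  have 3: "j / (2 * real N) * (lyap_inject N \<epsilon> \<eta> z + lyap_eject N \<epsilon> \<eta> z - 2 * v)
     = j / (2 * real N) * (lyap_inject N \<epsilon> \<eta> z + lyap_eject N \<epsilon> \<eta> z) - j / real N * v"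
    using N by (simp add: field_simps)
  have "\<epsilon> / (8 * real N) * v \<le> \<epsilon> / (8 * real N) * 1"
    using v \<epsilon> by (intro mult_left_mono) auto
  then show ?thesis using 1 2 3 unfolding v_def[symmetric] by (simp add: algebra_simps)
qed

section \<open>Contraction of the semigroup\<close>

definition eject :: "nat \<Rightarrow> int set \<Rightarrow> int set" where
  "eject N \<eta> = (if - int N \<in> \<eta> then \<eta> - {- int N} else \<eta> - {- int N + 1})"

lemma states_iff: "\<eta> \<in> states N \<longleftrightarrow> \<eta> \<subseteq> sites N"
  by (simp add: states_def sites_def)

lemma finite_states [simp]: "finite (states N)"
  by (simp add: states_def)

lemma swap_in_states: "x \<in> box N \<Longrightarrow> \<eta> \<in> states N \<Longrightarrow> swap \<eta> x \<in> states N"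
  unfolding states_iff by (auto simp: mem_swap_iff) (metis transpose_sites transpose_involutory subsetD)

lemma inject_in_states: "N \<ge> 1 \<Longrightarrow> \<eta> \<in> states N \<Longrightarrow> inject N \<eta> \<in> states N"
  by (auto simp: states_iff inject_def sites_def)

lemma eject_in_states: "\<eta> \<in> states N \<Longrightarrow> eject N \<eta> \<in> states N"
  by (auto simp: states_iff eject_def)

text \<open>At each end at most one of the two factors \<open>D_plus\<close> or
  \<open>D_minus\<close> is nonzero; if both vanish, \<open>inject\<close> or \<open>eject\<close>
  fixes the configuration.\<close>

lemma gen_eq:
  assumes "N \<ge> 2"
  shows "gen N j f \<eta> = (\<Sum>x\<in>box N. f (swap \<eta> x) - f \<eta>) / 2
     + j / (2 * real N) * (f (inject N \<eta>) - f \<eta>) + j / (2 * real N) * (f (eject N \<eta>) - f \<eta>)"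
proof -
  have p: "{int N - 1 + 1 .. int N} = {int N}" "{int N + 1 .. int N} = {}" by auto
  have m: "{- int N .. - int N + 1 - 1} = {- int N}" "{- int N .. - int N - 1} = {}" by auto
  have "Lb_plus N j f \<eta> = j / (2 * real N) * (f (inject N \<eta>) - f \<eta>)"
    unfolding Lb_plus_def I_plus_def D_plus_def
    by (simp add: p inject_def flip_def occ_def insert_absorb del: diff_add_cancel)
  moreover have "Lb_minus N j f \<eta> = j / (2 * real N) * (f (eject N \<eta>) - f \<eta>)"
    unfolding Lb_minus_def I_minus_def D_minus_def
    by (simp add: m eject_def flip_def occ_def del: add_diff_cancel_right')
  ultimately show ?thesis by (simp add: gen_def L0_def box_def)
qed

text \<open>Total rate, idle events included: \<open>2 * N\<close> bonds at rate 1/2 and two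
  boundary events at rate \<open>j / (2 * N)\<close>.\<close>

definition rate :: "nat \<Rightarrow> real \<Rightarrow> real" where
  "rate N j = real N + j / real N"

text \<open>Uniformization: \<open>gen N j = rate N j * (avg N j - 1)\<close> with a Markov operator
  \<open>avg N j\<close> on functions, and \<open>step N j\<close> is its transpose on measures.\<close>
definition avg :: "nat \<Rightarrow> real \<Rightarrow> (int set \<Rightarrow> real) \<Rightarrow> int set \<Rightarrow> real" where
  "avg N j f \<eta> = f \<eta> + gen N j f \<eta> / rate N j"

definition step :: "nat \<Rightarrow> real \<Rightarrow> (int set \<Rightarrow> real) \<Rightarrow> int set \<Rightarrow> real" where
  "step N j m \<zeta> = m \<zeta> + fwd N j m \<zeta> / rate N j"

lemma rate_pos: "N \<ge> 1 \<Longrightarrow> j > 0 \<Longrightarrow> 0 < rate N j"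
  by (simp add: rate_def add_pos_pos)

lemma avg_eq:
  assumes N: "N \<ge> 2" and j: "j > 0"
  shows "rate N j * avg N j f \<eta> = (\<Sum>x\<in>box N. f (swap \<eta> x)) / 2
     + j / (2 * real N) * (f (inject N \<eta>) + f (eject N \<eta>))"
proof -
  have "card (box N) = 2 * N" by (simp add: box_def)
  then have "(\<Sum>x\<in>box N. f (swap \<eta> x) - f \<eta>) / 2 = (\<Sum>x\<in>box N. f (swap \<eta> x)) / 2 - real N * f \<eta>"
    by (simp add: sum_subtractf diff_divide_distrib)
  moreover have "rate N j * avg N j f \<eta> = rate N j * f \<eta> + gen N j f \<eta>"
    using rate_pos[of N j] N j by (simp add: avg_def field_simps)
  moreover define J where "J = j / (2 * real N)"
  moreover have "rate N j = real N + 2 * J" using N by (simp add: rate_def J_def field_simps)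
  ultimately show ?thesis unfolding gen_eq[OF N] J_def[symmetric] by (simp add: algebra_simps)
qed

lemma dual_in_states: "dual N \<eta> \<in> states N"
  by (auto simp: states_iff dual_def)

lemma eject_dual:
  assumes "N \<ge> 2" "\<eta> \<in> states N"
  shows "eject N \<eta> = dual N (inject N (dual N \<eta>))"
  using assms by (auto simp: eject_def inject_def dual_def states_iff sites_def)

lemma dual_remove:
  assumes "z \<in> sites N" "z \<notin> \<eta>"
  shows "dual N \<eta> = insert (- z) (dual N (insert z \<eta>))" "- z \<notin> dual N (insert z \<eta>)"
  using assms by (auto simp: dual_def sites_def)

locale reservoir =
  fixes N :: nat and j \<epsilon> :: real
  assumes N: "N \<ge> 2" and j: "0 < j"
    and \<epsilon>: "0 < \<epsilon>" "\<epsilon> * (160 * real N) \<le> 1" "\<epsilon> * (8 * real N) \<le> j"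
begin

lemma N1: "N \<ge> 1"
  using N by simp

section \<open>Functions that are Lipschitz relative to \<open>lyap\<close>\<close>

definition lip :: "real \<Rightarrow> (int set \<Rightarrow> real) \<Rightarrow> bool" where
  "lip c f \<longleftrightarrow> (\<forall>\<eta>\<in>states N. \<forall>z\<in>sites N - \<eta>. \<bar>f (insert z \<eta>) - f \<eta>\<bar> \<le> c * lyap N \<epsilon> \<eta> z)"

lemma lipD:
  "lip c f \<Longrightarrow> \<eta> \<in> states N \<Longrightarrow> z \<in> sites N \<Longrightarrow> z \<notin> \<eta> \<Longrightarrow> \<bar>f (insert z \<eta>) - f \<eta>\<bar> \<le> c * lyap N \<epsilon> \<eta> z"
  by (auto simp: lip_def)

lemma lip_dual:
  assumes "lip c f"
  shows "lip c (\<lambda>\<eta>. f (dual N \<eta>))"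
  unfolding lip_def
proof (intro ballI)
  fix \<eta> z assume \<eta>: "\<eta> \<in> states N" and "z \<in> sites N - \<eta>"
  then have z: "z \<in> sites N" "z \<notin> \<eta>" by auto
  have "\<bar>f (insert (- z) (dual N (insert z \<eta>))) - f (dual N (insert z \<eta>))\<bar>
      \<le> c * lyap N \<epsilon> (dual N (insert z \<eta>)) (- z)"
    by (rule lipD[OF assms dual_in_states]) (use z dual_remove(2)[OF z] in \<open>auto simp: sites_def\<close>)
  then show "\<bar>f (dual N (insert z \<eta>)) - f (dual N \<eta>)\<bar> \<le> c * lyap N \<epsilon> \<eta> z"
    unfolding dual_remove(1)[OF z, symmetric] lyap_dual[OF z(1)] by (simp add: abs_minus_commute)
qed

text \<open>Injecting into both configurations merges them, moves the discrepancy from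
  \<open>N\<close> to \<open>N - 1\<close>, or leaves it at \<open>z\<close>: the three cases of
  \<open>lyap_inject\<close>.\<close>

lemma lip_inject:
  assumes f: "lip c f" and \<eta>: "\<eta> \<in> states N" and z: "z \<in> sites N" "z \<notin> \<eta>"
  shows "\<bar>f (inject N (insert z \<eta>)) - f (inject N \<eta>)\<bar> \<le> c * lyap_inject N \<epsilon> \<eta> z"
proof (cases "dies_right N \<eta> z")
  case True
  then have "inject N (insert z \<eta>) = inject N \<eta>"
    using z by (auto simp: inject_def dies_right_def insert_absorb)
  then show ?thesis using True by (simp add: lyap_inject_def)
next
  case alive: False
  show ?thesis
  proof (cases "z = int N")
    case True
    have "inject N (insert z \<eta>) = insert (int N - 1) (insert (int N) \<eta>)" "inject N \<eta> = insert (int N) \<eta>"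
      using True z by (auto simp: inject_def)
    moreover have "insert (int N) \<eta> \<in> states N" "int N - 1 \<in> sites N" "int N - 1 \<notin> insert (int N) \<eta>"
      using True \<eta> z N alive by (auto simp: states_iff sites_def dies_right_def)
    ultimately show ?thesis using lipD[OF f] alive True by (simp add: lyap_inject_def)
  next
    case False
    then have "inject N (insert z \<eta>) = insert z (inject N \<eta>)" "z \<notin> inject N \<eta>"
      using z alive by (auto simp: inject_def dies_right_def)
    then show ?thesis
      using lipD[OF f inject_in_states[OF N1 \<eta>] z(1)] alive False by (simp add: lyap_inject_def)
  qed
qed

lemma lip_eject:
  assumes f: "lip c f" and \<eta>: "\<eta> \<in> states N" and z: "z \<in> sites N" "z \<notin> \<eta>"
  shows "\<bar>f (eject N (insert z \<eta>)) - f (eject N \<eta>)\<bar> \<le> c * lyap_eject N \<epsilon> \<eta> z"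
proof -
  have "insert z \<eta> \<in> states N" using \<eta> z by (auto simp: states_iff)
  moreover have "\<bar>f (dual N (inject N (insert (- z) (dual N (insert z \<eta>)))))
       - f (dual N (inject N (dual N (insert z \<eta>))))\<bar> \<le> c * lyap_eject N \<epsilon> \<eta> z"
    unfolding lyap_eject_def
    by (rule lip_inject[OF lip_dual[OF f] dual_in_states])
      (use z dual_remove(2)[OF z] in \<open>auto simp: sites_def\<close>)
  ultimately show ?thesis
    using \<eta> unfolding dual_remove(1)[OF z, symmetric] by (simp add: eject_dual[OF N] abs_minus_commute)
qed

definition \<theta> :: real where
  "\<theta> = 1 - \<epsilon> / (8 * real N) / rate N j"

lemma rate_gt_0: "0 < rate N j"
  using N j rate_pos by simp

lemma \<theta>: "0 \<le> \<theta>" "\<theta> < 1"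
proof -
  have ge: "\<epsilon> * 1 \<le> \<epsilon> * (8 * real N)" "\<epsilon> * 1 \<le> \<epsilon> * (160 * real N)"
    using N \<epsilon> by (intro mult_left_mono; simp)+
  then have "\<epsilon> / (8 * real N) \<le> \<epsilon>" using N by (simp add: divide_le_eq)
  also have "\<dots> \<le> 1" using ge(2) \<epsilon>(2) by simp
  also have "1 \<le> real N" using N by simp
  also have "\<dots> \<le> rate N j" using j by (simp add: rate_def)
  finally have "\<epsilon> / (8 * real N) / rate N j \<le> 1"
    by (simp only: pos_divide_le_eq[OF rate_gt_0] mult_1)
  then show "0 \<le> \<theta>" by (simp add: \<theta>_def)
  show "\<theta> < 1" using rate_gt_0 N \<epsilon> by (simp add: \<theta>_def)
qed

text \<open>Each event acts on both configurations at once and leaves them equal or one site apart.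
  The differences of \<open>f\<close> are thus bounded by \<open>lyap\<close> at the new positions,
  which \<open>lyap_drift\<close> controls on average.\<close>

lemma lip_avg:
  assumes f: "lip c f" and c: "0 \<le> c"
  shows "lip (c * \<theta>) (avg N j f)"
  unfolding lip_def
proof (intro ballI)
  fix \<eta> z assume \<eta>: "\<eta> \<in> states N" and "z \<in> sites N - \<eta>"
  then have z: "z \<in> sites N" "z \<notin> \<eta>" by auto
  define J where "J = j / (2 * real N)"
  have J: "0 \<le> J" using j by (simp add: J_def)
  define A where "A x = f (swap (insert z \<eta>) x) - f (swap \<eta> x)" for x
  define B where "B = f (inject N (insert z \<eta>)) - f (inject N \<eta>)"
  define C where "C = f (eject N (insert z \<eta>)) - f (eject N \<eta>)"
  have "\<bar>A x\<bar> \<le> c * lyap N \<epsilon> (swap \<eta> x) (transpose x (x + 1) z)" if x: "x \<in> box N" for x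
  proof -
    have "swap (insert z \<eta>) x = insert (transpose x (x + 1) z) (swap \<eta> x)"
      by (auto simp: mem_swap_iff transpose_eq_iff)
    then show ?thesis
      unfolding A_def using lipD[OF f swap_in_states[OF x \<eta>] transpose_sites[OF x z(1)]] z
      by (simp add: mem_swap_iff)
  qed
  then have 1: "\<bar>\<Sum>x\<in>box N. A x\<bar> \<le> c * (\<Sum>x\<in>box N. lyap N \<epsilon> (swap \<eta> x) (transpose x (x + 1) z))"
    unfolding sum_distrib_left by (intro order_trans[OF sum_abs] sum_mono) auto
  have 2: "\<bar>J * (B + C)\<bar> \<le> c * (J * (lyap_inject N \<epsilon> \<eta> z + lyap_eject N \<epsilon> \<eta> z))"
  proof -
    have "\<bar>B + C\<bar> \<le> c * lyap_inject N \<epsilon> \<eta> z + c * lyap_eject N \<epsilon> \<eta> z"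
      using lip_inject[OF f \<eta> z] lip_eject[OF f \<eta> z] unfolding B_def C_def by linarith
    from mult_left_mono[OF this J] show ?thesis
      unfolding abs_mult abs_of_nonneg[OF J] by (simp add: algebra_simps)
  qed
  have "rate N j * (avg N j f (insert z \<eta>) - avg N j f \<eta>) = (\<Sum>x\<in>box N. A x) / 2 + J * (B + C)"
    unfolding right_diff_distrib avg_eq[OF N j] A_def B_def C_def J_def
    by (simp add: sum_subtractf algebra_simps diff_divide_distrib)
  then have "\<bar>rate N j * (avg N j f (insert z \<eta>) - avg N j f \<eta>)\<bar>
      \<le> c * ((\<Sum>x\<in>box N. lyap N \<epsilon> (swap \<eta> x) (transpose x (x + 1) z)) / 2
           + J * (lyap_inject N \<epsilon> \<eta> z + lyap_eject N \<epsilon> \<eta> z))"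
    using 1 2 unfolding distrib_left by simp
  also have "\<dots> \<le> c * ((rate N j - \<epsilon> / (8 * real N)) * lyap N \<epsilon> \<eta> z)"
    unfolding J_def rate_def
    by (intro mult_left_mono lyap_drift c) (use N z j \<epsilon> in auto)
  also have "\<dots> = rate N j * (c * \<theta> * lyap N \<epsilon> \<eta> z)"
    using rate_gt_0 by (simp add: \<theta>_def field_simps)
  finally show "\<bar>avg N j f (insert z \<eta>) - avg N j f \<eta>\<bar> \<le> c * \<theta> * lyap N \<epsilon> \<eta> z"
    using rate_gt_0 by (simp add: abs_mult)
qed

lemma lip_avg_funpow:
  assumes f: "lip c f" and c: "0 \<le> c"
  shows "lip (c * \<theta> ^ k) ((avg N j ^^ k) f)"
proof (induction k)
  case (Suc k)
  have "lip (c * \<theta> ^ k * \<theta>) (avg N j ((avg N j ^^ k) f))"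
    by (rule lip_avg[OF Suc]) (use c \<theta> in simp)
  then show ?case by (simp add: mult_ac)
qed (use f in simp)

text \<open>Any configuration is built from the empty one site by site, each step costing at most
  \<open>c\<close> since \<open>lyap\<close> is at most 1.\<close>

lemma lip_osc:
  assumes f: "lip c f" and c: "0 \<le> c" and \<eta>: "\<eta> \<in> states N"
  shows "\<bar>f \<eta> - f {}\<bar> \<le> c * (2 * real N + 1)"
proof -
  have fin: "finite \<eta>" using \<eta> finite_subset[of \<eta> "sites N"] by (simp add: states_iff)
  have "\<bar>f \<eta> - f {}\<bar> \<le> c * real (card \<eta>)"
    using fin \<eta>
  proof (induction \<eta> rule: finite_induct)
    case (insert z \<eta>)
    then have *: "\<eta> \<in> states N" "z \<in> sites N" by (auto simp: states_iff)
    have "c * lyap N \<epsilon> \<eta> z \<le> c * 1"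
      using lyap_bounds(2)[of N z \<epsilon> \<eta>] * N \<epsilon> c by (intro mult_left_mono) auto
    then have "\<bar>f (insert z \<eta>) - f \<eta>\<bar> \<le> c" using lipD[OF f *] insert by auto
    then show ?case using insert * by (simp add: algebra_simps)
  qed simp
  also have "card \<eta> \<le> card (sites N)" using \<eta> by (intro card_mono) (auto simp: states_iff)
  then have "c * real (card \<eta>) \<le> c * (2 * real N + 1)"
    using c by (intro mult_left_mono) (auto simp: sites_def)
  finally show ?thesis .
qed

section \<open>Measures in duality with functions\<close>

definition pairing :: "(int set \<Rightarrow> real) \<Rightarrow> (int set \<Rightarrow> real) \<Rightarrow> real" where
  "pairing m f = (\<Sum>\<eta>\<in>states N. m \<eta> * f \<eta>)"

lemma gen_indicator_outside:
  assumes "\<eta> \<in> states N" "\<zeta> \<notin> states N"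
  shows "gen N j (\<lambda>\<xi>. if \<xi> = \<zeta> then 1 else 0) \<eta> = 0"
proof -
  have "swap \<eta> x \<noteq> \<zeta>" if "x \<in> box N" for x using assms swap_in_states[OF that] by auto
  then show ?thesis
    using assms inject_in_states[OF N1, of \<eta>] eject_in_states[of \<eta> N] by (auto simp: gen_eq[OF N])
qed

lemma fwd_outside: "\<zeta> \<notin> states N \<Longrightarrow> fwd N j m \<zeta> = 0"
  by (simp add: fwd_def gen_indicator_outside)

lemma gen_expand:
  assumes \<eta>: "\<eta> \<in> states N"
  shows "(\<Sum>\<zeta>\<in>states N. gen N j (\<lambda>\<xi>. if \<xi> = \<zeta> then 1 else 0) \<eta> * f \<zeta>) = gen N j f \<eta>"
proof -
  have ev: "(\<Sum>\<zeta>\<in>states N. (if \<xi> = \<zeta> then 1 else 0) * f \<zeta>) = f \<xi>" if "\<xi> \<in> states N" for \<xi>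
    using that by (simp add: if_distrib[of "\<lambda>x. x * _"] sum.delta cong: if_cong)
  define \<delta> :: "int set \<Rightarrow> int set \<Rightarrow> real" where "\<delta> \<xi> \<zeta> = (if \<xi> = \<zeta> then 1 else 0) - (if \<eta> = \<zeta> then 1 else 0)" for \<xi> \<zeta>
  have \<delta>: "(\<Sum>\<zeta>\<in>states N. \<delta> \<xi> \<zeta> * f \<zeta>) = f \<xi> - f \<eta>" if "\<xi> \<in> states N" for \<xi>
    unfolding \<delta>_def left_diff_distrib sum_subtractf ev[OF that] ev[OF \<eta>] ..
  have "(\<Sum>\<zeta>\<in>states N. gen N j (\<lambda>\<xi>. if \<xi> = \<zeta> then 1 else 0) \<eta> * f \<zeta>)
      = (\<Sum>\<zeta>\<in>states N. (\<Sum>x\<in>box N. \<delta> (swap \<eta> x) \<zeta> * f \<zeta>) / 2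
          + j / (2 * real N) * (\<delta> (inject N \<eta>) \<zeta> * f \<zeta>) + j / (2 * real N) * (\<delta> (eject N \<eta>) \<zeta> * f \<zeta>))"
    unfolding gen_eq[OF N] \<delta>_def by (simp add: sum_distrib_right distrib_right mult.assoc)
  also have "\<dots> = (\<Sum>\<zeta>\<in>states N. \<Sum>x\<in>box N. \<delta> (swap \<eta> x) \<zeta> * f \<zeta>) / 2
          + j / (2 * real N) * (\<Sum>\<zeta>\<in>states N. \<delta> (inject N \<eta>) \<zeta> * f \<zeta>)
          + j / (2 * real N) * (\<Sum>\<zeta>\<in>states N. \<delta> (eject N \<eta>) \<zeta> * f \<zeta>)"
    unfolding sum.distrib sum_divide_distrib[symmetric] sum_distrib_left[symmetric] ..
  also have "(\<Sum>\<zeta>\<in>states N. \<Sum>x\<in>box N. \<delta> (swap \<eta> x) \<zeta> * f \<zeta>) = (\<Sum>x\<in>box N. f (swap \<eta> x) - f \<eta>)"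
    by (subst sum.swap) (intro sum.cong refl \<delta> swap_in_states \<eta>)
  finally show ?thesis
    unfolding gen_eq[OF N] by (simp only: \<delta>[OF inject_in_states[OF N1 \<eta>]] \<delta>[OF eject_in_states[OF \<eta>]])
qed

lemma pairing_fwd: "pairing (fwd N j m) f = pairing m (gen N j f)"
proof -
  have "pairing (fwd N j m) f
     = (\<Sum>\<zeta>\<in>states N. \<Sum>\<eta>\<in>states N. m \<eta> * (gen N j (\<lambda>\<xi>. if \<xi> = \<zeta> then 1 else 0) \<eta> * f \<zeta>))"
    by (simp add: pairing_def fwd_def sum_distrib_right mult.assoc)
  also have "\<dots> = pairing m (gen N j f)"
    unfolding pairing_def
    by (subst sum.swap) (intro sum.cong refl, simp add: sum_distrib_left[symmetric] gen_expand)
  finally show ?thesis .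
qed

lemma pairing_step: "pairing (step N j m) f = pairing m (avg N j f)"
proof -
  have "pairing (step N j m) f = pairing m f + pairing (fwd N j m) f / rate N j"
    by (simp add: pairing_def step_def sum.distrib algebra_simps sum_divide_distrib)
  also have "\<dots> = pairing m (avg N j f)"
    unfolding pairing_fwd by (simp add: pairing_def avg_def sum.distrib algebra_simps sum_divide_distrib)
  finally show ?thesis .
qed

lemma pairing_step_funpow: "pairing ((step N j ^^ k) m) f = pairing m ((avg N j ^^ k) f)"
  by (induction k arbitrary: f) (simp_all add: pairing_step funpow_swap1[of "avg N j"])

lemma pairing_indicator: "\<zeta> \<in> states N \<Longrightarrow> pairing m (\<lambda>\<xi>. if \<xi> = \<zeta> then 1 else 0) = m \<zeta>"
  by (simp add: pairing_def if_distrib cong: if_cong)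

lemma avg_nonneg:
  assumes "\<And>\<eta>. 0 \<le> f \<eta>"
  shows "0 \<le> avg N j f \<eta>"
proof -
  have "0 \<le> rate N j * avg N j f \<eta>"
    unfolding avg_eq[OF N j] using j assms by (intro add_nonneg_nonneg divide_nonneg_nonneg sum_nonneg mult_nonneg_nonneg) auto
  then show ?thesis using rate_gt_0 by (simp add: zero_le_mult_iff)
qed

lemma is_prob_step:
  assumes m: "is_prob N m"
  shows "is_prob N (step N j m)"
  unfolding is_prob_def
proof (intro conjI allI ballI impI)
  fix \<zeta> assume "\<zeta> \<notin> states N"
  then show "step N j m \<zeta> = 0" using m by (simp add: step_def fwd_outside is_prob_def)
next
  fix \<zeta> assume \<zeta>: "\<zeta> \<in> states N"
  have "step N j m \<zeta> = pairing m (avg N j (\<lambda>\<xi>. if \<xi> = \<zeta> then 1 else 0))"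
    using pairing_indicator[OF \<zeta>, of "step N j m"] by (simp add: pairing_step)
  also have "\<dots> \<ge> 0"
    unfolding pairing_def using m
    by (intro sum_nonneg mult_nonneg_nonneg avg_nonneg) (auto simp: is_prob_def)
  finally show "0 \<le> step N j m \<zeta>" .
next
  have "avg N j (\<lambda>_. 1) = (\<lambda>_. 1)" by (rule ext) (simp add: avg_def gen_eq[OF N])
  then show "(\<Sum>\<eta>\<in>states N. step N j m \<eta>) = 1"
    using pairing_step[of m "\<lambda>_. 1"] m by (simp add: pairing_def is_prob_def)
qed

lemma is_prob_step_funpow: "is_prob N m \<Longrightarrow> is_prob N ((step N j ^^ k) m)"
  by (induction k) (auto intro: is_prob_step)

lemma is_prob_bounds:
  assumes "is_prob N m"
  shows "0 \<le> m \<eta>" "m \<eta> \<le> 1"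
proof -
  show "0 \<le> m \<eta>" using assms by (cases "\<eta> \<in> states N") (auto simp: is_prob_def)
  show "m \<eta> \<le> 1"
  proof (cases "\<eta> \<in> states N")
    case True
    then show ?thesis
      using assms member_le_sum[of \<eta> "states N" m] by (auto simp: is_prob_def)
  qed (use assms in \<open>auto simp: is_prob_def\<close>)
qed

lemma pairing_prob_le:
  assumes m: "is_prob N m" and f: "\<And>\<eta>. \<eta> \<in> states N \<Longrightarrow> \<bar>f \<eta> - a\<bar> \<le> D"
  shows "\<bar>pairing m f - a\<bar> \<le> D"
proof -
  have "pairing m f - a = (\<Sum>\<eta>\<in>states N. m \<eta> * (f \<eta> - a))"
    using m by (simp add: pairing_def is_prob_def right_diff_distrib sum_subtractf sum_distrib_right[symmetric])
  also have "\<bar>\<dots>\<bar> \<le> (\<Sum>\<eta>\<in>states N. m \<eta> * D)"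
    using f is_prob_bounds(1)[OF m]
    by (intro order_trans[OF sum_abs] sum_mono) (simp add: abs_mult mult_left_mono)
  also have "\<dots> = D" using m by (simp add: is_prob_def sum_distrib_right[symmetric])
  finally show ?thesis .
qed

lemma tv_step_le:
  assumes \<mu>: "is_prob N \<mu>" and \<nu>: "is_prob N \<nu>"
  shows "tv_norm N (\<lambda>\<eta>. (step N j ^^ k) \<mu> \<eta> - (step N j ^^ k) \<nu> \<eta>) \<le> 20 * real N * \<theta> ^ k"
proof -
  \<comment> \<open>Tested against its own sign, the difference yields its norm.\<close>
  define s where "s \<eta> = sgn ((step N j ^^ k) \<mu> \<eta> - (step N j ^^ k) \<nu> \<eta>)" for \<eta>
  define g where "g = (avg N j ^^ k) s"
  \<comment> \<open>The oscillation 2 of a sign function, divided by the lower bound 1/2 of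
    \<open>lyap\<close>.\<close>
  have "lip 4 s"
    unfolding lip_def
  proof (intro ballI)
    fix \<eta> z assume "\<eta> \<in> states N" "z \<in> sites N - \<eta>"
    then have "1 / 2 \<le> lyap N \<epsilon> \<eta> z" using lyap_bounds(1)[of N z \<epsilon> \<eta>] N \<epsilon> by auto
    moreover have "\<bar>s (insert z \<eta>) - s \<eta>\<bar> \<le> 2" by (auto simp: s_def sgn_if)
    ultimately show "\<bar>s (insert z \<eta>) - s \<eta>\<bar> \<le> 4 * lyap N \<epsilon> \<eta> z" by linarith
  qed
  then have "lip (4 * \<theta> ^ k) g" unfolding g_def by (rule lip_avg_funpow) simp
  then have osc: "\<bar>g \<eta> - g {}\<bar> \<le> 4 * \<theta> ^ k * (2 * real N + 1)" if "\<eta> \<in> states N" for \<eta>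
    using lip_osc[OF _ _ that] \<theta> by simp
  have "tv_norm N (\<lambda>\<eta>. (step N j ^^ k) \<mu> \<eta> - (step N j ^^ k) \<nu> \<eta>)
      = pairing ((step N j ^^ k) \<mu>) s - pairing ((step N j ^^ k) \<nu>) s"
    unfolding tv_norm_def pairing_def sum_subtractf[symmetric] left_diff_distrib[symmetric] s_def
    by (simp add: abs_sgn)
  also have "\<dots> = pairing \<mu> g - pairing \<nu> g" by (simp add: pairing_step_funpow g_def)
  also have "\<dots> \<le> 2 * (4 * \<theta> ^ k * (2 * real N + 1))"
    using pairing_prob_le[OF \<mu>, of g "g {}", OF osc] pairing_prob_le[OF \<nu>, of g "g {}", OF osc] by linarith
  also have "\<dots> = (16 * real N + 8) * \<theta> ^ k" by (simp add: algebra_simps)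
  also have "\<dots> \<le> 20 * real N * \<theta> ^ k"
    using N \<theta> by (intro mult_right_mono) auto
  finally show ?thesis .
qed

section \<open>The law as a Poisson mixture of iterates of \<open>step\<close>\<close>

lemma fwd_eq_step: "fwd N j m \<zeta> = rate N j * (step N j m \<zeta> - m \<zeta>)"
  using rate_gt_0 by (simp add: step_def)

lemma fwd_funpow_diff:
  "(fwd N j ^^ n) (\<lambda>\<zeta>. c * (m \<zeta> - m' \<zeta>)) = (\<lambda>\<zeta>. c * ((fwd N j ^^ n) m \<zeta> - (fwd N j ^^ n) m' \<zeta>))"
proof (induction n arbitrary: c m m')
  case (Suc n)
  have "fwd N j (\<lambda>\<zeta>. c * (u \<zeta> - v \<zeta>)) = (\<lambda>\<zeta>. c * (fwd N j u \<zeta> - fwd N j v \<zeta>))" for u v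
    by (auto simp: fwd_def sum_distrib_left sum_subtractf[symmetric] algebra_simps)
  then show ?case using Suc by simp
qed simp

lemma alternating_pascal:
  fixes s :: "nat \<Rightarrow> real"
  shows "(\<Sum>k\<le>Suc n. real (Suc n choose k) * (-1) ^ (Suc n - k) * s k)
     = (\<Sum>k\<le>n. real (n choose k) * (-1) ^ (n - k) * s (Suc k))
       - (\<Sum>k\<le>n. real (n choose k) * (-1) ^ (n - k) * s k)"
proof -
  have "(\<Sum>k\<le>n. real (n choose Suc k) * (-1) ^ (n - k) * s (Suc k))
      = (\<Sum>k<n. real (n choose Suc k) * (-1) ^ (n - k) * s (Suc k))"
    by (rule sum.mono_neutral_right) (auto simp: not_less)
  also have "\<dots> = - (\<Sum>k<n. real (n choose Suc k) * (-1) ^ (n - Suc k) * s (Suc k))"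
    unfolding sum_negf[symmetric]
    by (intro sum.cong refl) (simp add: Suc_diff_Suc[symmetric])
  finally have "(\<Sum>k\<le>n. real (n choose Suc k) * (-1) ^ (n - k) * s (Suc k)) + (-1) ^ Suc n * s 0
      = - (\<Sum>k\<le>n. real (n choose k) * (-1) ^ (n - k) * s k)"
    unfolding lessThan_Suc_atMost[symmetric] sum.lessThan_Suc_shift by simp
  then show ?thesis
    by (simp add: sum.atMost_Suc_shift sum.distrib distrib_right del: sum.atMost_Suc)
qed

text \<open>The binomial expansion of a power of \<open>rate N j\<close> times (\<open>step\<close>
  minus the identity). The induction applies the innermost factor first, so the hypothesis is used
  for \<open>step N j m\<close> and for \<open>m\<close>.\<close>

lemma fwd_funpow_eq:
  "(fwd N j ^^ n) m \<zeta> = rate N j ^ n * (\<Sum>k\<le>n. real (n choose k) * (-1) ^ (n - k) * (step N j ^^ k) m \<zeta>)"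
proof (induction n arbitrary: m)
  case (Suc n)
  have "(fwd N j ^^ Suc n) m \<zeta> = (fwd N j ^^ n) (\<lambda>\<zeta>. rate N j * (step N j m \<zeta> - m \<zeta>)) \<zeta>"
    unfolding fwd_eq_step[symmetric] by (simp add: funpow_swap1)
  also have "\<dots> = rate N j * ((fwd N j ^^ n) (step N j m) \<zeta> - (fwd N j ^^ n) m \<zeta>)"
    unfolding fwd_funpow_diff ..
  finally show ?case
    unfolding Suc alternating_pascal by (simp add: funpow_swap1 algebra_simps)
qed simp

lemma poisson_sums:
  fixes x :: real
  shows "(\<lambda>k. x ^ k / fact k) sums exp x"
  using exp_converges[of x] by (simp add: field_simps)

lemma summable_poisson_prob:
  fixes x :: real
  assumes "is_prob N \<mu>"
  shows "summable (\<lambda>k. \<bar>x ^ k / fact k * (step N j ^^ k) \<mu> \<zeta>\<bar>)"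
proof (rule summable_comparison_test[OF _ sums_summable[OF poisson_sums[of "\<bar>x\<bar>"]]], intro exI allI impI)
  fix k
  have "\<bar>(step N j ^^ k) \<mu> \<zeta>\<bar> \<le> 1"
    using is_prob_bounds[OF is_prob_step_funpow[OF assms]] by (simp add: abs_le_iff order_trans[of _ 0])
  then show "norm \<bar>x ^ k / fact k * (step N j ^^ k) \<mu> \<zeta>\<bar> \<le> \<bar>x\<bar> ^ k / fact k"
    by (simp add: abs_mult power_abs mult_left_le divide_right_mono)
qed

text \<open>By the binomial expansion, the exponential series of \<open>fwd\<close> is the Cauchy
  product of the series of \<open>step\<close> with that of
  \<open>exp (- (rate N j * t))\<close>.\<close>

lemma law_eq:
  assumes \<mu>: "is_prob N \<mu>"
  shows "law N j \<mu> t \<zeta> = exp (- (rate N j * t)) * (\<Sum>k. (rate N j * t) ^ k / fact k * (step N j ^^ k) \<mu> \<zeta>)"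
proof -
  define a where "a k = (rate N j * t) ^ k / fact k * (step N j ^^ k) \<mu> \<zeta>" for k
  define b where "b k = (- (rate N j * t)) ^ k / fact k" for k
  have "summable (\<lambda>k. norm (b k))"
    using sums_summable[OF poisson_sums[of "\<bar>rate N j * t\<bar>"]] by (simp add: b_def power_abs)
  moreover have "summable (\<lambda>k. norm (a k))" using summable_poisson_prob[OF \<mu>] by (simp add: a_def)
  ultimately have "(\<Sum>k. a k) * (\<Sum>k. b k) = (\<Sum>n. \<Sum>k\<le>n. a k * b (n - k))" by (intro Cauchy_product)
  moreover have "(\<Sum>k\<le>n. a k * b (n - k)) = t ^ n / fact n * (fwd N j ^^ n) \<mu> \<zeta>" for n
  proof -
    have "a k * b (n - k) = t ^ n / fact n * (rate N j ^ n * (real (n choose k) * (-1) ^ (n - k) * (step N j ^^ k) \<mu> \<zeta>))"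
      if "k \<le> n" for k
    proof -
      have "(rate N j * t) ^ k * (- (rate N j * t)) ^ (n - k) = (-1) ^ (n - k) * (rate N j * t) ^ n"
        using that by (subst power_minus) (simp add: power_add[symmetric] mult.left_commute)
      then show ?thesis using that
        by (simp add: a_def b_def binomial_fact power_mult_distrib field_simps)
    qed
    then show ?thesis unfolding fwd_funpow_eq by (simp add: sum_distrib_left)
  qed
  ultimately have "law N j \<mu> t \<zeta> = (\<Sum>k. a k) * (\<Sum>k. b k)" by (simp add: law_def)
  then show ?thesis
    using sums_unique[OF poisson_sums[of "- (rate N j * t)"]] by (simp add: a_def b_def mult.commute)
qed

text \<open>Averaging \<open>\<theta> ^ k\<close> over a Poisson number of steps with mean
  \<open>x\<close> gives \<open>exp (- x + x * \<theta>)\<close>.\<close>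

lemma tv_law_le:
  assumes \<mu>: "is_prob N \<mu>" and \<nu>: "is_prob N \<nu>" and t: "0 \<le> t"
  shows "tv_norm N (\<lambda>\<eta>. law N j \<mu> t \<eta> - law N j \<nu> t \<eta>) \<le> 20 * real N * exp (- (\<epsilon> / (8 * real N) * t))"
proof -
  define x where "x = rate N j * t"
  define d where "d k \<zeta> = (step N j ^^ k) \<mu> \<zeta> - (step N j ^^ k) \<nu> \<zeta>" for k \<zeta>
  have x: "0 \<le> x" using rate_gt_0 t by (simp add: x_def)
  have sm: "summable (\<lambda>k. x ^ k / fact k * (step N j ^^ k) m \<zeta>)" if "is_prob N m" for m \<zeta>
    using summable_poisson_prob[OF that] by (rule summable_rabs_cancel)
  have sd: "summable (\<lambda>k. \<bar>x ^ k / fact k * d k \<zeta>\<bar>)" for \<zeta>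
  proof (rule summable_comparison_test[OF _ summable_add[OF summable_poisson_prob[OF \<mu>] summable_poisson_prob[OF \<nu>]]],
      intro exI allI impI)
    fix k
    show "norm \<bar>x ^ k / fact k * d k \<zeta>\<bar>
      \<le> \<bar>x ^ k / fact k * (step N j ^^ k) \<mu> \<zeta>\<bar> + \<bar>x ^ k / fact k * (step N j ^^ k) \<nu> \<zeta>\<bar>"
      unfolding d_def right_diff_distrib real_norm_def abs_idempotent by (rule abs_triangle_ineq4)
  qed
  have law: "law N j \<mu> t \<zeta> - law N j \<nu> t \<zeta> = exp (- x) * (\<Sum>k. x ^ k / fact k * d k \<zeta>)" for \<zeta>
    unfolding law_eq[OF \<mu>] law_eq[OF \<nu>] x_def[symmetric] d_def right_diff_distrib
      suminf_diff[OF sm[OF \<mu>] sm[OF \<nu>], symmetric] ..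
  have "tv_norm N (\<lambda>\<eta>. law N j \<mu> t \<eta> - law N j \<nu> t \<eta>)
      \<le> (\<Sum>\<zeta>\<in>states N. exp (- x) * (\<Sum>k. \<bar>x ^ k / fact k * d k \<zeta>\<bar>))"
    unfolding tv_norm_def law abs_mult[of "exp (- x)"] abs_exp_cancel
    by (intro sum_mono mult_left_mono summable_rabs sd) auto
  also have "\<dots> = exp (- x) * (\<Sum>k. \<Sum>\<zeta>\<in>states N. \<bar>x ^ k / fact k * d k \<zeta>\<bar>)"
    using sd by (simp add: sum_distrib_left[symmetric] suminf_sum)
  also have "(\<Sum>k. \<Sum>\<zeta>\<in>states N. \<bar>x ^ k / fact k * d k \<zeta>\<bar>) \<le> (\<Sum>k. 20 * real N * ((x * \<theta>) ^ k / fact k))"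
  proof (rule suminf_le)
    fix k
    have "(\<Sum>\<zeta>\<in>states N. \<bar>x ^ k / fact k * d k \<zeta>\<bar>) = x ^ k / fact k * tv_norm N (d k)"
      using x by (simp add: tv_norm_def abs_mult sum_distrib_left)
    also have "\<dots> \<le> x ^ k / fact k * (20 * real N * \<theta> ^ k)"
      using tv_step_le[OF \<mu> \<nu>, of k] x by (intro mult_left_mono) (auto simp: d_def[abs_def])
    finally show "(\<Sum>\<zeta>\<in>states N. \<bar>x ^ k / fact k * d k \<zeta>\<bar>) \<le> 20 * real N * ((x * \<theta>) ^ k / fact k)"
      by (simp add: power_mult_distrib field_simps)
  next
    show "summable (\<lambda>k. \<Sum>\<zeta>\<in>states N. \<bar>x ^ k / fact k * d k \<zeta>\<bar>)" by (intro summable_sum sd)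
    show "summable (\<lambda>k. 20 * real N * ((x * \<theta>) ^ k / fact k))"
      by (intro summable_mult sums_summable[OF poisson_sums])
  qed
  also have "(\<Sum>k. 20 * real N * ((x * \<theta>) ^ k / fact k)) = 20 * real N * exp (x * \<theta>)"
    by (intro sums_unique[symmetric] sums_mult poisson_sums)
  finally have "tv_norm N (\<lambda>\<eta>. law N j \<mu> t \<eta> - law N j \<nu> t \<eta>) \<le> exp (- x) * (20 * real N * exp (x * \<theta>))"
    by simp
  also have "\<dots> = 20 * real N * exp (- x + x * \<theta>)" unfolding exp_add by simp
  also have "- x + x * \<theta> = - (\<epsilon> / (8 * real N) * t)"
    using rate_gt_0 by (simp add: x_def \<theta>_def field_simps)
  finally show ?thesis .
qed

section \<open>Existence and uniqueness of the stationary measure\<close>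

text \<open>Consecutive iterates from the empty configuration differ by a geometric sequence, so
  they converge pointwise; \<open>step\<close> is a finite sum, hence continuous, and fixes the
  limit.\<close>

lemma ex_stationary: "\<exists>\<pi>. is_prob N \<pi> \<and> step N j \<pi> = \<pi>"
proof -
  define p where "p k = (step N j ^^ k) (\<lambda>\<eta>. if \<eta> = {} then 1 else 0)" for k
  have p0: "is_prob N (\<lambda>\<eta>. if \<eta> = {} then 1 else 0)"
    by (auto simp: is_prob_def states_def)
  have p: "is_prob N (p k)" for k unfolding p_def by (rule is_prob_step_funpow[OF p0])
  have p_Suc: "step N j (p k) = p (Suc k)" for k by (simp add: p_def)
  have diff: "\<bar>p (Suc k) \<zeta> - p k \<zeta>\<bar> \<le> 20 * real N * \<theta> ^ k" for k \<zeta>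
  proof (cases "\<zeta> \<in> states N")
    case True
    then have "\<bar>p (Suc k) \<zeta> - p k \<zeta>\<bar> \<le> tv_norm N (\<lambda>\<eta>. p (Suc k) \<eta> - p k \<eta>)"
      unfolding tv_norm_def by (intro member_le_sum) auto
    \<comment> \<open>\<open>p (Suc k)\<close> is the \<open>k\<close>-th iterate from another
      initial measure, one \<open>step\<close> ahead.\<close>
    also have "\<dots> \<le> 20 * real N * \<theta> ^ k"
      using tv_step_le[OF is_prob_step[OF p0] p0, of k] by (simp add: p_def funpow_swap1)
    finally show ?thesis .
  next
    case False
    then have "p (Suc k) \<zeta> = 0" "p k \<zeta> = 0"
      using p[of k] p[of "Suc k"] by (auto simp: is_prob_def)
    then show ?thesis using \<theta> by simp
  qed
  have "convergent (\<lambda>k. p k \<zeta>)" for \<zeta>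
  proof -
    have "summable (\<lambda>k. p (Suc k) \<zeta> - p k \<zeta>)"
      by (rule summable_comparison_test[of _ "\<lambda>k. 20 * real N * \<theta> ^ k"])
        (use diff \<theta> in \<open>auto intro!: summable_mult summable_geometric\<close>)
    then have "convergent (\<lambda>n. \<Sum>k<n. p (Suc k) \<zeta> - p k \<zeta>)"
      by (simp add: summable_iff_convergent)
    then have "convergent (\<lambda>n. p 0 \<zeta> + (\<Sum>k<n. p (Suc k) \<zeta> - p k \<zeta>))"
      by (intro convergent_add convergent_const)
    then show ?thesis unfolding sum_lessThan_telescope[of "\<lambda>k. p k \<zeta>"] by simp
  qed
  then obtain \<pi> where \<pi>: "\<And>\<zeta>. (\<lambda>k. p k \<zeta>) \<longlonglongrightarrow> \<pi> \<zeta>"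
    unfolding convergent_def by metis
  have "is_prob N \<pi>"
    unfolding is_prob_def
  proof (intro conjI allI ballI impI)
    fix \<zeta> assume "\<zeta> \<notin> states N"
    then have "p k \<zeta> = 0" for k using p[of k] by (auto simp: is_prob_def)
    then show "\<pi> \<zeta> = 0" using \<pi>[of \<zeta>] LIMSEQ_unique[OF tendsto_const] by fastforce
  next
    fix \<zeta>
    show "0 \<le> \<pi> \<zeta>" by (rule LIMSEQ_le_const[OF \<pi>]) (use is_prob_bounds[OF p] in auto)
  next
    have "(\<lambda>k. \<Sum>\<zeta>\<in>states N. p k \<zeta>) \<longlonglongrightarrow> (\<Sum>\<zeta>\<in>states N. \<pi> \<zeta>)" by (intro tendsto_sum \<pi>)
    moreover have "(\<Sum>\<zeta>\<in>states N. p k \<zeta>) = 1" for k using p[of k] by (simp add: is_prob_def)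
    ultimately show "(\<Sum>\<zeta>\<in>states N. \<pi> \<zeta>) = 1" using LIMSEQ_unique[OF tendsto_const] by fastforce
  qed
  moreover have "step N j \<pi> = \<pi>"
  proof
    fix \<zeta>
    have "(\<lambda>k. step N j (p k) \<zeta>) \<longlonglongrightarrow> step N j \<pi> \<zeta>"
      unfolding step_def fwd_def using rate_gt_0 by (intro tendsto_intros \<pi>) auto
    moreover have "(\<lambda>k. step N j (p k) \<zeta>) \<longlonglongrightarrow> \<pi> \<zeta>"
      unfolding p_Suc by (rule LIMSEQ_Suc[OF \<pi>])
    ultimately show "step N j \<pi> \<zeta> = \<pi> \<zeta>" by (rule LIMSEQ_unique)
  qed
  ultimately show ?thesis by blast
qed

lemma law_stationary:
  assumes \<pi>: "is_prob N \<pi>" "step N j \<pi> = \<pi>"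
  shows "law N j \<pi> t \<zeta> = \<pi> \<zeta>"
proof -
  have "(step N j ^^ k) \<pi> = \<pi>" for k by (induction k) (simp_all add: \<pi>(2))
  moreover have "(\<Sum>k. (rate N j * t) ^ k / fact k * \<pi> \<zeta>) = exp (rate N j * t) * \<pi> \<zeta>"
    by (intro sums_unique[symmetric] sums_mult2 poisson_sums)
  ultimately show ?thesis by (simp add: law_eq[OF \<pi>(1)] exp_minus)
qed

lemma tv_law_mu_st_le:
  assumes \<mu>: "is_prob N \<mu>" and t: "0 \<le> t"
  shows "tv_norm N (\<lambda>\<eta>. law N j \<mu> t \<eta> - mu_st N j \<eta>) \<le> 20 * real N * exp (- (\<epsilon> / (8 * real N) * t))"
proof -
  obtain \<pi> where \<pi>: "is_prob N \<pi>" "step N j \<pi> = \<pi>" using ex_stationary by blast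
  \<comment> \<open>A competing invariant measure and \<pi> both stand still at integer times while
    the bound on their distance tends to 0.\<close>
  have "mu_st N j = \<pi>"
    unfolding mu_st_def
  proof (rule the_equality)
    show "is_prob N \<pi> \<and> (\<forall>t\<ge>0. \<forall>\<zeta>\<in>states N. law N j \<pi> t \<zeta> = \<pi> \<zeta>)"
      using \<pi> law_stationary by simp
  next
    fix \<nu> assume \<nu>: "is_prob N \<nu> \<and> (\<forall>t\<ge>0. \<forall>\<zeta>\<in>states N. law N j \<nu> t \<zeta> = \<nu> \<zeta>)"
    define a where "a = \<epsilon> / (8 * real N)"
    have a: "0 < a" using N \<epsilon> by (simp add: a_def)
    have "tv_norm N (\<lambda>\<eta>. \<nu> \<eta> - \<pi> \<eta>) \<le> 20 * real N * exp (- a) ^ n" for n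
    proof -
      have "tv_norm N (\<lambda>\<eta>. \<nu> \<eta> - \<pi> \<eta>) = tv_norm N (\<lambda>\<eta>. law N j \<nu> (real n) \<eta> - law N j \<pi> (real n) \<eta>)"
        unfolding tv_norm_def using \<nu> by (intro sum.cong) (auto simp: law_stationary[OF \<pi>])
      also have "\<dots> \<le> 20 * real N * exp (- (a * real n))"
        unfolding a_def by (rule tv_law_le) (use \<nu> \<pi> in auto)
      also have "exp (- (a * real n)) = exp (- a) ^ n"
        by (simp add: exp_of_nat_mult[symmetric] mult.commute)
      finally show ?thesis .
    qed
    moreover have "(\<lambda>n. 20 * real N * exp (- a) ^ n) \<longlonglongrightarrow> 20 * real N * 0"
      using a by (intro tendsto_mult_left LIMSEQ_realpow_zero) auto
    ultimately have "tv_norm N (\<lambda>\<eta>. \<nu> \<eta> - \<pi> \<eta>) \<le> 0"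
      by (intro LIMSEQ_le_const[of _ 0]) auto
    then have "tv_norm N (\<lambda>\<eta>. \<nu> \<eta> - \<pi> \<eta>) = 0"
      unfolding tv_norm_def by (intro antisym sum_nonneg) auto
    then have "\<nu> \<eta> = \<pi> \<eta>" if "\<eta> \<in> states N" for \<eta>
      using that by (simp add: tv_norm_def sum_nonneg_eq_0_iff)
    moreover have "\<nu> \<eta> = \<pi> \<eta>" if "\<eta> \<notin> states N" for \<eta>
      using that \<nu> \<pi> by (simp add: is_prob_def)
    ultimately show "\<nu> = \<pi>" by blast
  qed
  then show ?thesis using tv_law_le[OF \<mu> \<pi>(1) t] by (simp add: law_stationary[OF \<pi>])
qed

end

theorem theorem3p1:
  fixes j :: real
  assumes "j > 0"
  shows "\<exists>c b. b > 0 \<and> (\<forall>N::nat. N \<ge> 2 \<longrightarrow> (\<forall>\<mu>. is_prob N \<mu> \<longrightarrow> (\<forall>t>0.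
           tv_norm N (\<lambda>\<eta>. law N j \<mu> t \<eta> - mu_st N j \<eta>)
             \<le> c * real N * exp (- b * t / (real N)\<^sup>2))))"
proof -
  \<comment> \<open>Used with \<epsilon> equal to \<open>e / N\<close>: the two bounds are the
    locale assumptions, and the exponent \<open>\<epsilon> / (8 * N)\<close> becomes
    \<open>e / 8\<close> divided by \<open>N^2\<close>.\<close>
  define e where "e = min (1 / 160) (j / 8)"
  have e: "0 < e" "e \<le> 1 / 160" "e \<le> j / 8" using assms by (auto simp: e_def)
  have "tv_norm N (\<lambda>\<eta>. law N j \<mu> t \<eta> - mu_st N j \<eta>) \<le> 20 * real N * exp (- (e / 8) * t / (real N)\<^sup>2)"
    if N: "N \<ge> 2" and \<mu>: "is_prob N \<mu>" and t: "t > 0" for N \<mu> t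
  proof -
    interpret reservoir N j "e / real N"
      by unfold_locales (use N assms e in auto)
    have eq: "- (e / real N / (8 * real N) * t) = - (e / 8) * t / (real N)\<^sup>2"
      by (simp add: power2_eq_square)
    show ?thesis using tv_law_mu_st_le[OF \<mu> less_imp_le[OF t]] unfolding eq .
  qed
  then show ?thesis using e(1) by (intro exI[of _ 20] exI[of _ "e / 8"]) auto
qed

end
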